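(* For each integer $L\ge 1$ let $g_L$ denote the number of ways to dissect a $2L\times 2L$ chessboard into two polyominoes of equal area $2L^2$, and let $C_L(1)$ denote the number of self-avoiding walks crossing an $L\times L$ square (WCAS). Then for every $L\ge 1$ $$g_{L+2}\;\ge\;\left(\frac{C_L(1)}{L^2}\right)^4,$$ and $g_L$ grows as $\lambda^{4L^2}$, where $\lambda=\lim_{L\to\infty}C_L(1)^{1/L^2}$ is the growth constant of WCAS; that is, the limit $\lim_{L\to\infty} g_L^{1/(4L^2)}$ exists and $$\lim_{L\to\infty} g_L^{1/(4L^2)}=\lambda.$$
   Context: A $2L\times 2L$ chessboard consists of $4L^2$ unit cells. A polyomino is a nonempty set of cells that is connected, meaning any two of its cells can be joined by a path of cells in the set in which consecutive cells share an edge (holes are allowed). The gerrymander sequence $g_L$ (OEIS A348456) counts the unordered partitions of the cells of the $2L\times 2L$ chessboard into two polyominoes, each of area (number of cells) $2L^2$; configurations related by rotation or reflection of the board are counted as different (for example $g_1=2$, $g_2=70$). A self-avoiding walk is a sequence of distinct vertices of $\mathbb{Z}^2$, each a nearest neighbour of its predecessor. A WCAS (walk crossing a square) is a self-avoiding walk from $(0,0)$ to $(L,L)$ all of whose vertices lie in $\{0,1,\dots,L\}^2$; $C_L(1)$ is the number of such walks (of any length). It is a known result that the limit $\lambda=\lim_{L\to\infty}C_L(1)^{1/L^2}$ exists. *)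

theory Defs
  imports Complex_Main "HOL-Library.Disjoint_Sets"
begin

text \<open>Points of the square lattice serve both as vertices of walks and as unit cells, a cell
  being named by its lower left corner. Two cells share an edge iff their corners are nearest
  neighbours, so one adjacency relation serves for both.\<close>

definition lattice_adj :: "int \<times> int \<Rightarrow> int \<times> int \<Rightarrow> bool" where
  "lattice_adj u v \<longleftrightarrow> \<bar>fst u - fst v\<bar> + \<bar>snd u - snd v\<bar> = 1"

definition polyomino :: "(int \<times> int) set \<Rightarrow> bool" where
  "polyomino A \<longleftrightarrow> A \<noteq> {} \<and>
     (\<forall>a\<in>A. \<forall>b\<in>A. \<exists>p. p \<noteq> [] \<and> hd p = a \<and> last p = b \<and> set p \<subseteq> A \<and> successively lattice_adj p)"

definition chessboard :: "nat \<Rightarrow> (int \<times> int) set" where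
  "chessboard n = {0..<int n} \<times> {0..<int n}"

definition gerrymander :: "nat \<Rightarrow> nat" where
  "gerrymander L = card {P. partition_on (chessboard (2 * L)) P \<and> card P = 2 \<and>
     (\<forall>A\<in>P. polyomino A \<and> card A = 2 * L ^ 2)}"

definition self_avoiding_walk :: "(int \<times> int) list \<Rightarrow> bool" where
  "self_avoiding_walk p \<longleftrightarrow> p \<noteq> [] \<and> distinct p \<and> successively lattice_adj p"

text \<open>The square of side \<open>L\<close> has \<open>(L + 1)\<^sup>2\<close> vertices.\<close>

definition wcas :: "nat \<Rightarrow> (int \<times> int) list set" where
  "wcas L = {p. self_avoiding_walk p \<and> hd p = (0, 0) \<and> last p = (int L, int L) \<and>
     set p \<subseteq> {0..int L} \<times> {0..int L}}"

end

theory Submission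
  imports Defs "HOL-Analysis.Convex" "HOL-Real_Asymp.Real_Asymp"
begin

text \<open>
  Both bounds come from reading a dissection off the curve that separates its two parts. The
  interface of a dissection is the set of unit edges between a cell of one part and a cell of the
  other. It meets every inner lattice point in an even number of edges, and conversely an edge set
  with even degrees at all inner points two-colours the cells so that the colour changes exactly
  across its edges (\<open>colour_wall\<close>). This parity argument replaces the Jordan curve theorem in both
  directions.

  \<^bold>\<open>Upper bound.\<close> The interface contains a simple cycle or a simple path between two border points,
  because a longest path in it either ends on the border or can be closed up. The colouring of
  that cycle or path is constant on each part, since a connected part never crosses the interface;
  hence the cycle or path is already the whole interface (\<open>interface_eqI\<close>). A cycle is opened at a
  horizontal edge of its top row and continued upwards to the border, and the two ends of a
  border-to-border path are led to opposite corners through two rings of points laid around the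
  board. So \<open>gerrymander L\<close> is at most a polynomial in \<open>L\<close> times the number of walks
  crossing a square of side \<open>2 * L + 4\<close> (\<open>gerrymander_le\<close>).

  \<^bold>\<open>Lower bound.\<close> Put \<open>n = L + 2\<close>. Two walks crossing an \<open>L\<close>-square, stacked on top of each other, form
  a half walk through the left half of the \<open>2 * n\<close> board. Two half walks are joined through
  the middle column after the second one has been turned by 180 degrees. The resulting walk runs
  from the bottom to the top of the board, and the cells on each of its sides are connected
  (\<open>polyomino_right_part\<close>, \<open>polyomino_left_part\<close>). The half turn exchanges the two
  sides, so the parts have equal size as soon as the two half walks cut off equal areas in their
  halves. By the Cauchy-Schwarz inequality the number of pairs with equal areas is at least the
  square of the number of half walks divided by the number of possible areas, and that denominator
  is at most \<open>L ^ 8\<close> when \<open>L \<ge> 2\<close>. The case \<open>L = 1\<close> uses the larger family of the 16 walks up a ladder.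

  \<^bold>\<open>Limits.\<close> Chaining an odd number \<open>m\<close> of squares along each row, and an odd number of rows, gives
  \<open>card (wcas L) ^ m\<^sup>2 \<le> card (wcas (m * (L + 1) - 1))\<close>. With monotonicity and
  \<open>card (wcas L) \<le> 4 ^ (L + 1)\<^sup>2\<close> this forces \<open>ln (card (wcas (K - 1))) / K\<^sup>2\<close> to converge to its
  supremum, and the two bounds above transfer the limit to the gerrymander sequence.
\<close>

(* Points mostly occur as single variables, and splitting quantifiers over them into coordinates
   would hide the facts about points from the simplifier. *)
declare split_paired_All [simp del] split_paired_Ex [simp del]

type_synonym point = "int \<times> int"

section \<open>Walks inside a region\<close>

definition walks :: "point set \<Rightarrow> point \<Rightarrow> point \<Rightarrow> point list set" where
  "walks S s t = {p. self_avoiding_walk p \<and> hd p = s \<and> last p = t \<and> set p \<subseteq> S}"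

definition linked :: "point set \<Rightarrow> point \<Rightarrow> point \<Rightarrow> bool" where
  "linked X = (\<lambda>a b. a \<in> X \<and> b \<in> X \<and> lattice_adj a b)\<^sup>*\<^sup>*"

lemma lattice_adj_sym: "lattice_adj u v \<longleftrightarrow> lattice_adj v u"
  by (auto simp: lattice_adj_def)

lemma lattice_adj_Pair:
  "lattice_adj (a, b) w \<longleftrightarrow>
     w = (a + 1, b) \<or> w = (a - 1, b) \<or> w = (a, b + 1) \<or> w = (a, b - 1)"
  by (cases w) (auto simp: lattice_adj_def)

lemma wcas_eq_walks: "wcas L = walks ({0..int L} \<times> {0..int L}) (0, 0) (int L, int L)"
  by (simp add: wcas_def walks_def)

lemma walks_mono: "S \<subseteq> T \<Longrightarrow> walks S s t \<subseteq> walks T s t"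
  by (auto simp: walks_def)

lemma finite_walks: "finite S \<Longrightarrow> finite (walks S s t)"
  by (rule finite_subset[OF _ finite_subset_distinct[of S]])
     (auto simp: walks_def self_avoiding_walk_def)

lemma card_walks_mono:
  "S \<subseteq> T \<Longrightarrow> finite T \<Longrightarrow> card (walks S s t) \<le> card (walks T s t)"
  by (intro card_mono finite_walks walks_mono)

lemma walks_append:
  assumes "p \<in> walks S s t" "q \<in> walks T s' t'" "S \<inter> T = {}" "lattice_adj t s'"
  shows "p @ q \<in> walks (S \<union> T) s t'"
  using assms by (auto simp: walks_def self_avoiding_walk_def successively_append_iff)

text \<open>Concatenation is injective because the two regions are disjoint: the points of the first region
  pick out the first walk. All constructions of walks below are counted with this inequality, so
  no walk has to be taken apart by hand.\<close>

lemma card_walks_append: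
  assumes "S \<inter> T = {}" "lattice_adj t s'" "finite S" "finite T"
  shows "card (walks S s t) * card (walks T s' t') \<le> card (walks (S \<union> T) s t')"
proof -
  have "inj_on (\<lambda>(p, q). p @ q) (walks S s t \<times> walks T s' t')"
  proof (rule inj_onI, clarify)
    fix p q p' q' assume "p \<in> walks S s t" "q \<in> walks T s' t'"
      and "p' \<in> walks S s t" "q' \<in> walks T s' t'" and e: "p @ q = p' @ q'"
    then have "set p \<subseteq> S" "set p' \<subseteq> S" "set q \<inter> S = {}" "set q' \<inter> S = {}"
      using assms(1) by (auto simp: walks_def)
    then have "filter (\<lambda>x. x \<in> S) (p @ q) = p" "filter (\<lambda>x. x \<in> S) (p' @ q') = p'"
      by (simp_all add: filter_id_conv filter_empty_conv subset_iff disjoint_iff)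
    with e show "p = p' \<and> q = q'" by simp
  qed
  moreover have "(\<lambda>(p, q). p @ q) ` (walks S s t \<times> walks T s' t') \<subseteq> walks (S \<union> T) s t'"
    by (rule image_subsetI, elim SigmaE) (simp add: walks_append[OF _ _ assms(1,2)])
  ultimately show ?thesis
    using card_inj_on_le[of "\<lambda>(p, q). p @ q" "walks S s t \<times> walks T s' t'"]
      finite_walks[of "S \<union> T"] assms(3,4) by (auto simp: card_cartesian_product)
qed

lemma map_in_walks_iff:
  assumes "\<And>u v. lattice_adj (f u) (f v) \<longleftrightarrow> lattice_adj u v" "inj f"
  shows "map f p \<in> walks (f ` S) (f s) (f t) \<longleftrightarrow> p \<in> walks S s t"
  using assms(2)
  by (simp add: walks_def self_avoiding_walk_def distinct_map successively_map hd_map last_map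
      assms(1) inj_eq[OF assms(2)] inj_on_subset[OF assms(2)] inj_image_subset_iff cong: conj_cong)

lemma card_walks_image:
  assumes "\<And>u v. lattice_adj (f u) (f v) \<longleftrightarrow> lattice_adj u v" "inj f" "f s = s'" "f t = t'"
  shows "card (walks (f ` S) s' t') = card (walks S s t)"
proof -
  note iff = map_in_walks_iff[of f, OF assms(1,2)]
  have "walks (f ` S) (f s) (f t) \<subseteq> range (map f)"
  proof
    fix q assume "q \<in> walks (f ` S) (f s) (f t)"
    then have "set q \<subseteq> f ` S" by (simp add: walks_def)
    then have "\<exists>p. q = map f p" unfolding ex_map_conv by blast
    then show "q \<in> range (map f)" by blast
  qed
  then have "walks (f ` S) (f s) (f t) = map f ` walks S s t"
    using iff by blast
  moreover have "inj_on (map f) (walks S s t)" using assms(2) by (meson inj_mapI inj_on_subset subset_UNIV)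
  ultimately show ?thesis by (simp add: card_image assms(3,4)[symmetric])
qed

lemma walks_rev: "p \<in> walks S s t \<Longrightarrow> rev p \<in> walks S t s"
proof -
  have "(\<lambda>x y. lattice_adj y x) = lattice_adj"
    using lattice_adj_sym by blast
  then show "p \<in> walks S s t \<Longrightarrow> rev p \<in> walks S t s"
    unfolding walks_def self_avoiding_walk_def successively_rev mem_Collect_eq
    by (simp only:) (simp add: hd_rev last_rev)
qed

lemma linked_refl: "linked X a a"
  by (simp add: linked_def)

lemma linked_trans: "linked X a b \<Longrightarrow> linked X b c \<Longrightarrow> linked X a c"
  unfolding linked_def by (rule rtranclp_trans)

lemma linked_sym: "linked X a b \<Longrightarrow> linked X b a"
  unfolding linked_def
proof (induction rule: rtranclp_induct)
  case (step y z)
  then show ?case by (metis (mono_tags, lifting) converse_rtranclp_into_rtranclp lattice_adj_sym)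
qed auto

lemma linked_adj: "a \<in> X \<Longrightarrow> b \<in> X \<Longrightarrow> lattice_adj a b \<Longrightarrow> linked X a b"
  unfolding linked_def by auto

lemma linked_mono: "linked X a b \<Longrightarrow> X \<subseteq> Y \<Longrightarrow> linked Y a b"
  unfolding linked_def by (erule rtranclp_mono[THEN predicate2D, rotated]) auto

lemma linked_along:
  assumes "\<And>k. m \<le> k \<Longrightarrow> k \<le> n \<Longrightarrow> f k \<in> X"
    and "\<And>k. m \<le> k \<Longrightarrow> k < n \<Longrightarrow> lattice_adj (f k) (f (k + 1))" and "m \<le> (n::int)"
  shows "linked X (f m) (f n)"
  using assms(3,1,2)
proof (induction n rule: int_ge_induct)
  case (step i)
  then have "linked X (f m) (f i)" "linked X (f i) (f (i + 1))"
    by (auto intro!: linked_adj)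
  then show ?case by (rule linked_trans)
qed (simp add: linked_refl)

lemma linked_iff_path:
  assumes "a \<in> X"
  shows "linked X a b \<longleftrightarrow>
    (\<exists>p. p \<noteq> [] \<and> hd p = a \<and> last p = b \<and> set p \<subseteq> X \<and> successively lattice_adj p)"
    (is "_ \<longleftrightarrow> ?R b")
proof
  assume "linked X a b"
  then show "?R b" unfolding linked_def
  proof (induction rule: rtranclp_induct)
    case base
    show ?case using assms by (intro exI[of _ "[a]"]) auto
  next
    case (step y z)
    then obtain p where "p \<noteq> []" "hd p = a" "last p = y" "set p \<subseteq> X" "successively lattice_adj p"
      by auto
    then show ?case using step
      by (intro exI[of _ "p @ [z]"]) (auto simp: successively_append_iff)
  qed
next
  assume "?R b"
  then obtain p where "p \<noteq> []" "hd p = a" "last p = b" "set p \<subseteq> X" "successively lattice_adj p"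
    by auto
  then show "linked X a b"
  proof (induction p arbitrary: b rule: rev_induct)
    case (snoc x xs)
    show ?case
    proof (cases "xs = []")
      case False
      then have "linked X a (last xs)" "linked X (last xs) b"
        using snoc by (auto simp: successively_append_iff intro!: linked_adj)
      then show ?thesis by (rule linked_trans)
    qed (use snoc in \<open>auto simp: linked_refl\<close>)
  qed auto
qed

lemma polyomino_iff_linked:
  "polyomino A \<longleftrightarrow> A \<noteq> {} \<and> (\<forall>a\<in>A. \<forall>b\<in>A. linked A a b)"
  by (auto simp: polyomino_def linked_iff_path)

lemma walks_nonempty:
  assumes "linked X a b" "a \<in> X"
  shows "walks X a b \<noteq> {}"
  using assms(1) unfolding linked_def
proof (induction rule: rtranclp_induct)
  case base
  have "[a] \<in> walks X a a" using assms(2) by (auto simp: walks_def self_avoiding_walk_def)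
  then show ?case by auto
next
  case (step y z)
  then obtain p where p: "p \<in> walks X a y" by auto
  show ?case
  proof (cases "z \<in> set p")
    case True
    then obtain xs ys where "p = (xs @ [z]) @ ys" by (metis append.assoc append_Cons append_Nil split_list)
    moreover from this have "successively lattice_adj (xs @ [z])"
      using p by (metis (lifting) walks_def self_avoiding_walk_def mem_Collect_eq successively_append_iff)
    ultimately have "xs @ [z] \<in> walks X a z"
      using p by (cases xs) (auto simp: walks_def self_avoiding_walk_def)
    then show ?thesis by auto
  next
    case False
    then have "p @ [z] \<in> walks X a z"
      using p step by (auto simp: walks_def self_avoiding_walk_def successively_append_iff)
    then show ?thesis by auto
  qed
qed

text \<open>In this form a fixed connecting piece costs nothing when it is appended to a family of walks.\<close>

lemma card_walks_pos:
  assumes "linked X a b" "a \<in> X" "finite X"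
  shows "card (walks X a b) \<ge> 1"
  using walks_nonempty[OF assms(1,2)] finite_walks[OF assms(3)]
  by (simp add: Suc_le_eq card_gt_0_iff)

section \<open>Edge sets of walks\<close>

fun edges :: "point list \<Rightarrow> point set set" where
  "edges (u # v # p) = insert {u, v} (edges (v # p))"
| "edges _ = {}"

definition degree :: "point set set \<Rightarrow> point \<Rightarrow> nat" where
  "degree E w = card {e \<in> E. w \<in> e}"

lemma finite_edges: "finite (edges p)"
  by (induction p rule: edges.induct) auto

lemma edges_subset: "e \<in> edges p \<Longrightarrow> e \<subseteq> set p"
  by (induction p rule: edges.induct) auto

lemma edges_append:
  "p \<noteq> [] \<Longrightarrow> q \<noteq> [] \<Longrightarrow> edges (p @ q) = edges p \<union> edges q \<union> {{last p, hd q}}"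
proof (induction p rule: edges.induct)
  case ("2_2" a)
  then show ?case by (cases q) auto
qed auto

lemma edges_rev: "edges (rev p) = edges p"
proof (induction p)
  case (Cons a p)
  show ?case
  proof (cases p)
    case [simp]: (Cons b q)
    have "edges (rev (a # p)) = edges (rev p) \<union> {{b, a}}"
      unfolding rev.simps(2) by (subst edges_append) auto
    then show ?thesis using Cons.IH by (simp add: insert_commute)
  qed simp
qed auto

lemma edges_map: "edges (map f p) = (\<lambda>e. f ` e) ` edges p"
  by (induction p rule: edges.induct) auto

lemma edges_adj:
  "successively lattice_adj p \<Longrightarrow> e \<in> edges p \<Longrightarrow> \<exists>u v. e = {u, v} \<and> lattice_adj u v"
  by (induction p rule: edges.induct) auto

lemma vertex_in_edge: "v \<in> set p \<Longrightarrow> length p \<ge> 2 \<Longrightarrow> \<exists>e\<in>edges p. v \<in> e"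
proof (induction p rule: edges.induct)
  case (1 a b p)
  then show ?case by (cases p) auto
qed auto

lemma edge_split: "e \<in> edges p \<Longrightarrow> \<exists>xs a b ys. p = xs @ a # b # ys \<and> e = {a, b}"
proof (induction p rule: edges.induct)
  case (1 u v p)
  show ?case
  proof (cases "e = {u, v}")
    case True
    then show ?thesis by (metis append_Nil)
  next
    case False
    then have "e \<in> edges (v # p)" using 1(2) by simp
    then show ?thesis using 1(1) by (metis append_Cons)
  qed
qed auto

lemma edges_in_relation: "successively (\<lambda>u v. {u, v} \<in> I) p \<longleftrightarrow> edges p \<subseteq> I"
  by (induction p rule: edges.induct) auto

text \<open>The start lies on exactly one edge, which reveals the second point; removing that edge leaves
  the same situation for the rest of the walk. This lets dissections determine walks through their
  interfaces.\<close>

lemma walk_eqI: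
  assumes "distinct p" "distinct q" "hd p = hd q" "edges p = edges q" "p \<noteq> []" "q \<noteq> []"
  shows "p = q"
  using assms
proof (induction p arbitrary: q)
  case (Cons a p)
  then obtain q' where q: "q = a # q'" by (cases q) auto
  have nin: "e \<in> edges p \<Longrightarrow> a \<notin> e" "e \<in> edges q' \<Longrightarrow> a \<notin> e" for e
    using Cons(2,3) q edges_subset by (auto dest!: edges_subset)
  show ?case
  proof (cases p)
    case Nil
    then show ?thesis using Cons(5) q by (cases q') auto
  next
    case [simp]: (Cons b p')
    obtain c q'' where [simp]: "q' = c # q''" using Cons.prems(4) q by (cases q') auto
    have e: "insert {a, b} (edges p) = insert {a, c} (edges q')" using Cons.prems(4) q by simp
    then have bc: "b = c" using nin by (metis insertI1 insertE doubleton_eq_iff)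
    then have "edges p = edges q'" using e nin
      by (metis insertI1 insert_ident)
    then have "p = q'" using Cons.IH[of q'] Cons.prems(1,2) q bc by auto
    then show ?thesis using q by simp
  qed
qed auto

text \<open>Every passage of the walk through a point uses two edges there, and only the ends use one.\<close>

lemma even_degree_edges:
  assumes "distinct p" "p \<noteq> []"
  shows "even (degree (edges p) w + of_bool (w = hd p) + of_bool (w = last p))"
  using assms
proof (induction p rule: edges.induct)
  case (1 u v p)
  let ?E = "edges (v # p)"
  have "{u, v} \<notin> ?E" using 1(2) edges_subset[of "{u, v}" "v # p"] by auto
  moreover have "{e \<in> edges (u # v # p). w \<in> e} =
      (if w \<in> {u, v} then insert {u, v} {e \<in> ?E. w \<in> e} else {e \<in> ?E. w \<in> e})" by auto
  ultimately have "degree (edges (u # v # p)) w = degree ?E w + of_bool (w \<in> {u, v})"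
    unfolding degree_def by (auto simp: finite_edges)
  moreover have "even (degree ?E w + of_bool (w = v) + of_bool (w = last (v # p)))"
    using 1 by simp
  moreover have "u \<noteq> v" using 1(2) by auto
  ultimately show ?case by (cases "w = u"; cases "w = v") auto
qed (auto simp: degree_def)

lemma degree_insert:
  "finite E \<Longrightarrow> e \<notin> E \<Longrightarrow> degree (insert e E) w = degree E w + of_bool (w \<in> e)"
proof -
  assume a: "finite E" "e \<notin> E"
  have "{x \<in> insert e E. w \<in> x} = (if w \<in> e then insert e {x \<in> E. w \<in> x} else {x \<in> E. w \<in> x})"
    by auto
  then show ?thesis using a by (auto simp: degree_def)
qed

text \<open>Walks with a common start are told apart by their edges, and the edges in \<open>S\<close> are named
  by a lower or left end in \<open>S\<close> together with one of two directions.\<close>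

lemma card_walks_le:
  assumes "finite S"
  shows "card (walks S s t) \<le> 4 ^ card S"
proof -
  let ?F = "(\<lambda>(a, b). {(a, b), (a + 1, b)}) ` S \<union> (\<lambda>(a, b). {(a, b), (a, b + 1)}) ` S"
  have "card ?F \<le> card S + card S"
    using card_Un_le card_image_le[OF assms] by (meson add_mono order_trans)
  then have F: "card ?F \<le> 2 * card S" by simp
  have "e \<in> ?F" if p: "p \<in> walks S s t" "e \<in> edges p" for p e
  proof -
    obtain u v where uv: "e = {u, v}" "lattice_adj u v"
      using p edges_adj unfolding walks_def self_avoiding_walk_def by blast
    have "e \<subseteq> S" using p edges_subset by (fastforce simp: walks_def)
    with uv have *: "u \<in> S" "v \<in> S" by auto
    obtain a b where "u = (a, b)" by (cases u)
    with uv(2) consider "v = (a + 1, b)" | "u = (fst v + 1, snd v)" | "v = (a, b + 1)"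
      | "u = (fst v, snd v + 1)"
      by (auto simp: lattice_adj_Pair)
    then show ?thesis
    proof cases
      case 1
      then have "e = (\<lambda>(a, b). {(a, b), (a + 1, b)}) u" using uv \<open>u = (a, b)\<close> by simp
      then show ?thesis using *(1) by blast
    next
      case 2
      then have "e = (\<lambda>(a, b). {(a, b), (a + 1, b)}) v"
        using uv by (simp add: case_prod_unfold insert_commute)
      then show ?thesis using *(2) by blast
    next
      case 3
      then have "e = (\<lambda>(a, b). {(a, b), (a, b + 1)}) u" using uv \<open>u = (a, b)\<close> by simp
      then show ?thesis using *(1) by blast
    next
      case 4
      then have "e = (\<lambda>(a, b). {(a, b), (a, b + 1)}) v"
        using uv by (simp add: case_prod_unfold insert_commute)
      then show ?thesis using *(2) by blast
    qed
  qed
  then have "edges ` walks S s t \<subseteq> Pow ?F" by auto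
  moreover have "inj_on edges (walks S s t)"
    by (intro inj_onI walk_eqI) (auto simp: walks_def self_avoiding_walk_def)
  ultimately have "card (walks S s t) \<le> card (Pow ?F)"
    by (intro card_inj_on_le) (use assms in auto)
  also have "\<dots> = 2 ^ card ?F" using assms by (intro card_Pow) auto
  also have "\<dots> \<le> 2 ^ (2 * card S)" using F by (intro power_increasing) auto
  finally show ?thesis by (simp add: power_mult)
qed

section \<open>The growth constant of walks crossing a square\<close>

abbreviation rect :: "int \<Rightarrow> int \<Rightarrow> point set" where
  "rect a b \<equiv> {0..a} \<times> {0..b}"

definition crossings :: "int \<Rightarrow> int \<Rightarrow> nat" where
  "crossings a b = card (walks (rect a b) (0, 0) (a, b))"

lemma wcas_eq_crossings: "card (wcas L) = crossings (int L) (int L)"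
  by (simp add: wcas_eq_walks crossings_def)

lemma crossings_commute: "crossings a b = crossings b a"
proof -
  have "crossings a b = card (walks (prod.swap ` rect a b) (0, 0) (b, a))"
    unfolding crossings_def by (rule card_walks_image[symmetric]) (auto simp: lattice_adj_def)
  then show ?thesis by (simp add: crossings_def product_swap)
qed

text \<open>Three rectangles of equal height stand side by side with unit gaps. The walk in the middle
  one is reflected, so it runs down from the top corner that the first walk reaches to the bottom
  corner where the third one starts. Odd numbers of rectangles thus lead again to the opposite
  corner.\<close>

lemma crossings_chain:
  assumes "a \<ge> 0" "b \<ge> 0" "c \<ge> 0"
  shows "crossings a b * (crossings c b)\<^sup>2 \<le> crossings (a + 2 * (c + 1)) b"
proof -
  let ?f = "\<lambda>(x, y). (a + 1 + x, b - y)" and ?g = "\<lambda>(x, y). (a + c + 2 + x, y)"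
  have f: "crossings c b = card (walks (?f ` rect c b) (a + 1, b) (a + 1 + c, 0))"
    unfolding crossings_def
    by (rule card_walks_image[symmetric]) (auto simp: lattice_adj_def inj_def)
  have g: "crossings c b = card (walks (?g ` rect c b) (a + c + 2, 0) (a + c + 2 + c, b))"
    unfolding crossings_def
    by (rule card_walks_image[symmetric]) (auto simp: lattice_adj_def inj_def)
  have "crossings a b * crossings c b \<le> card (walks (rect a b \<union> ?f ` rect c b) (0, 0) (a + 1 + c, 0))"
    unfolding f crossings_def[of a b] by (rule card_walks_append) (auto simp: lattice_adj_def)
  then have "crossings a b * (crossings c b)\<^sup>2 \<le>
      card (walks (rect a b \<union> ?f ` rect c b) (0, 0) (a + 1 + c, 0)) * crossings c b"
    by (simp add: power2_eq_square)
  also have "\<dots> \<le> card (walks (rect a b \<union> ?f ` rect c b \<union> ?g ` rect c b) (0, 0) (a + c + 2 + c, b))"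
    unfolding g by (rule card_walks_append) (auto simp: lattice_adj_def)
  also have "\<dots> \<le> card (walks (rect (a + 2 * (c + 1)) b) (0, 0) (a + c + 2 + c, b))"
    by (rule card_walks_mono) (use assms in auto)
  also have "\<dots> = crossings (a + 2 * (c + 1)) b"
    by (simp add: crossings_def algebra_simps)
  finally show ?thesis .
qed

lemma crossings_power:
  assumes "c \<ge> 0" "b \<ge> 0"
  shows "crossings c b ^ (2 * k + 1) \<le> crossings (int (2 * k + 1) * (c + 1) - 1) b"
proof (induction k)
  case (Suc k)
  let ?a = "int (2 * k + 1) * (c + 1) - 1"
  have "crossings c b ^ (2 * Suc k + 1) = crossings c b ^ (2 * k + 1) * (crossings c b)\<^sup>2"
    by (simp add: power_add[symmetric])
  also have "\<dots> \<le> crossings ?a b * (crossings c b)\<^sup>2" using Suc by simp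
  also have "\<dots> \<le> crossings (?a + 2 * (c + 1)) b"
    using assms by (intro crossings_chain) auto
  also have "?a + 2 * (c + 1) = int (2 * Suc k + 1) * (c + 1) - 1"
    by (simp add: algebra_simps)
  finally show ?case .
qed auto

text \<open>First \<open>m\<close> squares are chained to a strip and then, with the axes exchanged, \<open>m\<close> strips to a
  square. The gaps of width one account for \<open>L + 1\<close> in place of \<open>L\<close>.\<close>

lemma wcas_power:
  assumes "odd m"
  shows "card (wcas L) ^ m\<^sup>2 \<le> card (wcas (m * (L + 1) - 1))"
proof -
  obtain k where k: "m = 2 * k + 1" using assms by (auto elim: oddE)
  let ?M = "int (2 * k + 1) * (int L + 1) - 1"
  have "?M = int (m * (L + 1) - 1)" by (simp add: k algebra_simps)
  have "card (wcas L) ^ m\<^sup>2 = (crossings L L ^ (2 * k + 1)) ^ (2 * k + 1)"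
    by (simp only: wcas_eq_crossings k power2_eq_square power_mult)
  also have "\<dots> \<le> crossings L ?M ^ (2 * k + 1)"
    using crossings_power[of "int L" "int L" k] crossings_commute by (intro power_mono) auto
  also have "\<dots> \<le> crossings ?M ?M" by (intro crossings_power) auto
  finally show ?thesis using \<open>?M = _\<close> by (simp add: wcas_eq_crossings)
qed

lemma card_wcas_le: "card (wcas L) \<le> 4 ^ (L + 1)\<^sup>2"
  using card_walks_le[of "rect L L" "(0, 0)" "(int L, int L)"]
  by (simp add: wcas_eq_walks card_cartesian_product power2_eq_square nat_add_distrib)

lemma card_wcas_Suc: "card (wcas L) \<le> card (wcas (Suc L))"
proof -
  let ?T = "{int L..int L + 1} \<times> {int L + 1}"
  have "linked ?T (int L, int L + 1) (int L + 1, int L + 1)"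
    by (intro linked_adj) (auto simp: lattice_adj_def)
  then have "1 \<le> card (walks ?T (int L, int L + 1) (int L + 1, int L + 1))"
    by (rule card_walks_pos) auto
  then have "card (wcas L) \<le>
      card (wcas L) * card (walks ?T (int L, int L + 1) (int L + 1, int L + 1))"
    by simp
  also have "\<dots> \<le> card (walks (rect L L \<union> ?T) (0, 0) (int L + 1, int L + 1))"
    unfolding wcas_eq_walks by (rule card_walks_append) (auto simp: lattice_adj_def)
  also have "\<dots> \<le> card (wcas (Suc L))"
    unfolding wcas_eq_walks by (subst (1 2 3 4) of_nat_Suc, subst (1 2 3 4) add.commute[of 1], rule card_walks_mono) auto
  finally show ?thesis .
qed

lemma card_wcas_mono: "L \<le> M \<Longrightarrow> card (wcas L) \<le> card (wcas M)"
  by (rule lift_Suc_mono_le[of "\<lambda>L. card (wcas L)"]) (auto simp: card_wcas_Suc)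

lemma card_wcas_pos: "card (wcas L) \<ge> 1"
proof -
  have "1 \<le> card (wcas 0)"
    unfolding wcas_eq_walks using card_walks_pos[OF linked_refl, of "(0, 0)" "rect 0 0"] by simp
  then show ?thesis using card_wcas_mono[of 0 L] by simp
qed

lemma card_wcas_0: "card (wcas 0) = 1"
proof -
  have "wcas 0 \<subseteq> {[(0, 0)]}"
  proof
    fix p assume "p \<in> wcas 0"
    then have "distinct p" "set p \<subseteq> {(0, 0)}" "p \<noteq> []"
      by (auto simp: wcas_def self_avoiding_walk_def)
    then show "p \<in> {[(0, 0)]}" by (cases p; cases "tl p") auto
  qed
  then show ?thesis
    using card_mono[of "{[(0::int, 0::int)]}" "wcas 0"] card_wcas_pos[of 0] by simp
qed

text \<open>A two-dimensional Fekete lemma. If \<open>b K / K\<^sup>2\<close> is close to the supremum for one \<open>K\<close>, then for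
  large \<open>M\<close> the largest odd multiple of \<open>K\<close> below \<open>M\<close> is at least \<open>M - 2 * K\<close>, and monotonicity carries
  the value over to \<open>M\<close>.\<close>

lemma quadratic_growth_limit:
  fixes b :: "nat \<Rightarrow> real"
  assumes mono: "\<And>K M. K \<le> M \<Longrightarrow> b K \<le> b M" and nonneg: "\<And>K. b K \<ge> 0"
    and upper: "\<And>K. b K \<le> c * (real K)\<^sup>2"
    and mult: "\<And>K m. odd m \<Longrightarrow> (real m)\<^sup>2 * b K \<le> b (m * K)"
  shows "\<exists>s. (\<lambda>K. b K / (real K)\<^sup>2) \<longlonglongrightarrow> s"
proof -
  define q where "q = (\<lambda>K. b K / (real K)\<^sup>2)"
  have bdd: "bdd_above (q ` {1..})"
    using upper by (intro bdd_aboveI[of _ c]) (auto simp: q_def divide_simps)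
  define s where "s = (SUP K\<in>{1..}. q K)"
  have le_s: "q K \<le> s" if "K \<ge> 1" for K
    unfolding s_def using bdd that by (intro cSUP_upper) auto
  have "q \<longlonglongrightarrow> s"
  proof (rule order_tendstoI)
    fix a assume "a > s"
    show "\<forall>\<^sub>F K in sequentially. q K < a"
      using eventually_ge_at_top[of 1] by eventually_elim (use le_s \<open>a > s\<close> in force)
  next
    fix a assume "a < s"
    then obtain K where K: "K \<ge> 1" "a < q K"
      unfolding s_def using less_cSUP_iff[OF _ bdd] by auto
    have "(\<lambda>M. (1 / real K - 2 / real M)\<^sup>2 * b K) \<longlonglongrightarrow> (1 / real K - 0)\<^sup>2 * b K"
      by (intro tendsto_intros)
    then have "\<forall>\<^sub>F M in sequentially. (1 / real K - 2 / real M)\<^sup>2 * b K > a"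
      using K by (intro order_tendstoD(1)) (auto simp: q_def power2_eq_square)
    then show "\<forall>\<^sub>F M in sequentially. a < q M"
      using eventually_ge_at_top[of "3 * K"]
    proof eventually_elim
      case (elim M)
      define m where "m = (if odd (M div K) then M div K else M div K - 1)"
      have "M div K \<ge> 3" using elim(2) K by (simp add: less_eq_div_iff_mult_less_eq)
      then have "odd m" "m \<le> M div K" "m + 1 \<ge> M div K" by (auto simp: m_def)
      then have "m * K \<le> M" by (meson div_times_less_eq_dividend mult_le_mono1 order_trans)
      (* m loses at most 2 against M / K: one by rounding and one by parity. *)
      have "real M / real K < real (M div K) + 1"
        using K by (metis floor_divide_of_nat_eq floor_less_iff less_add_same_cancel1 of_int_of_nat_eq real_of_int_floor_add_one_gt zero_less_one add.commute)
      then have m: "real M / real K - 2 \<le> real m" using \<open>m + 1 \<ge> M div K\<close> by linarith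
      have M: "real M \<ge> 3 * real K" using elim(2) by (metis of_nat_le_iff of_nat_mult of_nat_numeral)
      then have "real M / real K - 2 \<ge> 0" using K by (simp add: field_simps)
      then have "(real M / real K - 2)\<^sup>2 \<le> (real m)\<^sup>2" using m by (intro power_mono) auto
      then have "(real M / real K - 2)\<^sup>2 * b K \<le> (real m)\<^sup>2 * b K"
        using nonneg by (intro mult_right_mono)
      also have "\<dots> \<le> b (m * K)" using \<open>odd m\<close> by (rule mult)
      also have "\<dots> \<le> b M" using \<open>m * K \<le> M\<close> by (rule mono)
      finally have "(real M / real K - 2)\<^sup>2 * b K / (real M)\<^sup>2 \<le> q M"
        by (simp add: q_def divide_right_mono)
      moreover have "(real M / real K - 2)\<^sup>2 * b K / (real M)\<^sup>2 = (1 / real K - 2 / real M)\<^sup>2 * b K"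
        using M K by (simp add: power2_eq_square field_simps)
      ultimately show ?case using elim(1) by simp
    qed
  qed
  then show ?thesis by (auto simp: q_def)
qed

text \<open>Indexed by the number \<open>K\<close> of points on a side of the square, because this is the quantity
  that is multiplied by chaining.\<close>

definition log_wcas :: "nat \<Rightarrow> real" where
  "log_wcas K = ln (real (card (wcas (K - 1))))"

lemma log_wcas_limit: "\<exists>s. (\<lambda>K. log_wcas K / (real K)\<^sup>2) \<longlonglongrightarrow> s"
proof (rule quadratic_growth_limit[where c = "ln 4"])
  have pos: "0 < real (card (wcas L))" for L using card_wcas_pos[of L] by linarith
  show "log_wcas K \<le> log_wcas M" if "K \<le> M" for K M
    unfolding log_wcas_def using that pos card_wcas_mono[of "K - 1" "M - 1"] by simp
  show "log_wcas K \<ge> 0" for K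
    unfolding log_wcas_def using card_wcas_pos[of "K - 1"] by simp
  show "log_wcas K \<le> ln 4 * (real K)\<^sup>2" for K
  proof (cases K)
    case 0
    then show ?thesis by (simp add: log_wcas_def card_wcas_0)
  next
    case (Suc L)
    have "real (card (wcas L)) \<le> 4 ^ (L + 1)\<^sup>2"
      using card_wcas_le[of L] by (metis of_nat_le_iff of_nat_numeral of_nat_power)
    then have "ln (real (card (wcas L))) \<le> ln (4 ^ (L + 1)\<^sup>2)"
      using pos by (subst ln_le_cancel_iff) auto
    then show ?thesis using Suc by (simp add: log_wcas_def ln_realpow add.commute mult.commute)
  qed
  show "(real m)\<^sup>2 * log_wcas K \<le> log_wcas (m * K)" if "odd m" for m K
  proof (cases K)
    case 0
    then show ?thesis by (simp add: log_wcas_def card_wcas_0)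
  next
    case (Suc L)
    have "real (card (wcas L)) ^ m\<^sup>2 \<le> real (card (wcas (m * (L + 1) - 1)))"
      using wcas_power[OF that, of L] by (metis of_nat_le_iff of_nat_power)
    then have "ln (real (card (wcas L)) ^ m\<^sup>2) \<le> ln (real (card (wcas (m * (L + 1) - 1))))"
      using pos by (subst ln_le_cancel_iff) auto
    then show ?thesis using Suc by (simp add: log_wcas_def ln_realpow pos)
  qed
qed

section \<open>Two-colourings of the cells by edge sets\<close>

definition hedge :: "point set set \<Rightarrow> int \<Rightarrow> int \<Rightarrow> bool" where
  "hedge E x y \<longleftrightarrow> {(x, y), (x + 1, y)} \<in> E"

definition vedge :: "point set set \<Rightarrow> int \<Rightarrow> int \<Rightarrow> bool" where
  "vedge E x y \<longleftrightarrow> {(x, y), (x, y + 1)} \<in> E"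

definition lattice_edges :: "point set set \<Rightarrow> bool" where
  "lattice_edges E \<longleftrightarrow> (\<forall>e\<in>E. \<exists>u v. e = {u, v} \<and> lattice_adj u v)"

definition even_inside :: "int \<Rightarrow> point set set \<Rightarrow> bool" where
  "even_inside N E \<longleftrightarrow> (\<forall>x y. 0 < x \<and> x < N \<and> 0 < y \<and> y < N \<longrightarrow> even (degree E (x, y)))"

text \<open>The parity of the number of edges crossed on the way from the cell \<open>(0, 0)\<close> up the first
  column and then to the right along row \<open>j\<close>.\<close>

definition colour :: "point set set \<Rightarrow> point \<Rightarrow> bool" where
  "colour E = (\<lambda>(i, j).
     odd (card {y \<in> {1..j}. hedge E 0 y} + card {x \<in> {1..i}. vedge E x j}))"

text \<open>For adjacent cells this is the unit edge between them; the formula covers all four relative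
  positions at once.\<close>

definition wall :: "point \<Rightarrow> point \<Rightarrow> point set" where
  "wall = (\<lambda>(a, b) (c, d). {(max a c, max b d), (min a c + 1, min b d + 1)})"

lemma degree_eq:
  assumes "lattice_edges E"
  shows "degree E (x, y) = of_bool (hedge E (x - 1) y) + of_bool (hedge E x y)
    + of_bool (vedge E x (y - 1)) + of_bool (vedge E x y)"
proof -
  let ?F = "{{(x - 1, y), (x, y)}, {(x, y), (x + 1, y)}, {(x, y - 1), (x, y)}, {(x, y), (x, y + 1)}}"
  have "{e \<in> E. (x, y) \<in> e} = ?F \<inter> {e. e \<in> E}"
  proof (intro equalityI subsetI)
    fix e assume e: "e \<in> {e \<in> E. (x, y) \<in> e}"
    then obtain u v where uv: "e = {u, v}" "lattice_adj u v"
      using assms unfolding lattice_edges_def by blast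
    then have "u = (x, y) \<or> v = (x, y)" using e by auto
    then obtain w where "e = {(x, y), w}" "lattice_adj (x, y) w"
      using uv lattice_adj_sym by (metis insert_commute)
    then show "e \<in> ?F \<inter> {e. e \<in> E}" using e
      by (auto simp: lattice_adj_Pair insert_commute)
  qed auto
  then have "degree E (x, y) = (\<Sum>e\<in>?F. of_bool (e \<in> E))"
    by (subst sum_of_bool_eq) (auto simp: degree_def)
  then show ?thesis
    by (simp add: hedge_def vedge_def doubleton_eq_iff)
qed

lemma card_int_step:
  fixes b :: int
  assumes "a \<le> b + 1"
  shows "card {x. a \<le> x \<and> x \<le> b + 1 \<and> P x} = card {x. a \<le> x \<and> x \<le> b \<and> P x} + of_bool (P (b + 1))"
proof -
  have "x \<le> b + 1 \<longleftrightarrow> x = b + 1 \<or> x \<le> b" for x by auto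
  then have "{x. a \<le> x \<and> x \<le> b + 1 \<and> P x} =
      (if P (b + 1) then insert (b + 1) {x. a \<le> x \<and> x \<le> b \<and> P x} else {x. a \<le> x \<and> x \<le> b \<and> P x})"
    using assms by auto
  moreover have "finite {x. a \<le> x \<and> x \<le> b \<and> P x}"
    by (rule finite_subset[of _ "{a..b}"]) auto
  ultimately show ?thesis by auto
qed

lemma colour_right:
  "i \<ge> 0 \<Longrightarrow> colour E (i + 1, j) \<noteq> colour E (i, j) \<longleftrightarrow> vedge E (i + 1) j"
  by (auto simp: colour_def card_int_step)

text \<open>Moving one column to the right changes both colours at once by the two vertical edges at
  \<open>(i + 1, j + 1)\<close>; even degree at this point makes the discrepancy equal to the change between the two
  horizontal edges there.\<close>

lemma colour_up:
  assumes "lattice_edges E" "even_inside N E" "0 \<le> i" "i < N" "0 \<le> j" "j + 1 < N"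
  shows "colour E (i, j + 1) \<noteq> colour E (i, j) \<longleftrightarrow> hedge E i (j + 1)"
  using assms(3,4)
proof (induction i rule: int_ge_induct)
  case base
  have empty: "{x. 1 \<le> x \<and> x \<le> (0::int) \<and> P x} = {}" for P by auto
  show ?case using assms(5) by (auto simp: colour_def card_int_step empty)
next
  case (step i)
  have "even (degree E (i + 1, j + 1))"
    using assms step by (simp add: even_inside_def)
  then have "even (of_bool (hedge E i (j + 1)) + of_bool (hedge E (i + 1) (j + 1))
      + of_bool (vedge E (i + 1) j) + of_bool (vedge E (i + 1) (j + 1)) :: nat)"
    unfolding degree_eq[OF assms(1)] by simp
  moreover have "colour E (i, j + 1) \<noteq> colour E (i, j) \<longleftrightarrow> hedge E i (j + 1)"
    using step by simp
  moreover note colour_right[OF step(1), of E j] colour_right[OF step(1), of E "j + 1"]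
  ultimately show ?case by (auto split: if_splits simp: of_bool_def)
qed

lemma wall_simps [simp]:
  "wall (i, j) (i + 1, j) = {(i + 1, j), (i + 1, j + 1)}"
  "wall (i, j) (i, j + 1) = {(i, j + 1), (i + 1, j + 1)}"
  "wall (i, j) (i - 1, j) = {(i, j), (i, j + 1)}"
  "wall (i, j) (i, j - 1) = {(i, j), (i + 1, j)}"
  by (auto simp: wall_def)

definition cells :: "int \<Rightarrow> point set" where
  "cells N = {0..<N} \<times> {0..<N}"

lemma chessboard_eq_cells: "chessboard n = cells (int n)"
  by (simp add: chessboard_def cells_def)

lemma colour_wall:
  assumes "lattice_edges E" "even_inside N E" "a \<in> cells N" "b \<in> cells N" "lattice_adj a b"
  shows "colour E a \<noteq> colour E b \<longleftrightarrow> wall a b \<in> E"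
proof -
  obtain i j where a: "a = (i, j)" by (cases a)
  consider "b = (i + 1, j)" | "b = (i - 1, j)" | "b = (i, j + 1)" | "b = (i, j - 1)"
    using assms(5) by (auto simp: a lattice_adj_Pair)
  then show ?thesis
  proof cases
    case 1
    then show ?thesis using colour_right[of i E j] assms by (auto simp: a cells_def vedge_def)
  next
    case 2
    then show ?thesis using colour_right[of "i - 1" E j] assms by (auto simp: a cells_def vedge_def)
  next
    case 3
    then show ?thesis using colour_up[OF assms(1,2), of i j] assms
      by (auto simp: a cells_def hedge_def)
  next
    case 4
    then show ?thesis using colour_up[OF assms(1,2), of i "j - 1"] assms
      by (auto simp: a cells_def hedge_def)
  qed
qed

lemma cells_linked: "a \<in> cells N \<Longrightarrow> linked (cells N) (0, 0) a"
proof -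
  assume "a \<in> cells N"
  then obtain i j where a: "a = (i, j)" "0 \<le> i" "i < N" "0 \<le> j" "j < N" by (auto simp: cells_def)
  have "linked (cells N) ((\<lambda>k. (k, 0)) 0) ((\<lambda>k. (k, 0)) i)"
    by (rule linked_along) (use a in \<open>auto simp: cells_def lattice_adj_def\<close>)
  moreover have "linked (cells N) ((\<lambda>k. (i, k)) 0) ((\<lambda>k. (i, k)) j)"
    by (rule linked_along) (use a in \<open>auto simp: cells_def lattice_adj_def\<close>)
  ultimately show ?thesis using linked_trans a(1) by auto
qed

lemma linked_invariant:
  assumes "linked X a b"
    and "\<And>u v. u \<in> X \<Longrightarrow> v \<in> X \<Longrightarrow> lattice_adj u v \<Longrightarrow> f u = f v"
  shows "f a = f b"
  using assms(1) unfolding linked_def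
  by (induction rule: rtranclp_induct) (use assms(2) in auto)

section \<open>The interface of a dissection\<close>

definition interface :: "int \<Rightarrow> point set \<Rightarrow> point set set" where
  "interface N A =
     {{(x, y), (x, y + 1)} | x y. 0 < x \<and> x < N \<and> 0 \<le> y \<and> y < N \<and> ((x - 1, y) \<in> A) \<noteq> ((x, y) \<in> A)}
   \<union> {{(x, y), (x + 1, y)} | x y. 0 \<le> x \<and> x < N \<and> 0 < y \<and> y < N \<and> ((x, y - 1) \<in> A) \<noteq> ((x, y) \<in> A)}"

lemma vedge_interface:
  "vedge (interface N A) x y \<longleftrightarrow>
     0 < x \<and> x < N \<and> 0 \<le> y \<and> y < N \<and> ((x - 1, y) \<in> A) \<noteq> ((x, y) \<in> A)"
  by (auto simp: vedge_def interface_def doubleton_eq_iff)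

lemma hedge_interface:
  "hedge (interface N A) x y \<longleftrightarrow>
     0 \<le> x \<and> x < N \<and> 0 < y \<and> y < N \<and> ((x, y - 1) \<in> A) \<noteq> ((x, y) \<in> A)"
  by (auto simp: hedge_def interface_def doubleton_eq_iff)

lemma lattice_edges_interface: "lattice_edges (interface N A)"
  unfolding lattice_edges_def interface_def by (fastforce simp: lattice_adj_def)

lemma interface_subset_box: "e \<in> interface N A \<Longrightarrow> e \<subseteq> rect N N"
  by (auto simp: interface_def)

lemma finite_interface: "finite (interface N A)"
proof (rule finite_subset)
  show "interface N A \<subseteq> Pow (rect N N)" using interface_subset_box by blast
qed auto

lemma interface_wall:
  assumes "a \<in> cells N" "b \<in> cells N" "lattice_adj a b"
  shows "wall a b \<in> interface N A \<longleftrightarrow> (a \<in> A) \<noteq> (b \<in> A)"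
proof -
  obtain i j where a: "a = (i, j)" by (cases a)
  consider "b = (i + 1, j)" | "b = (i - 1, j)" | "b = (i, j + 1)" | "b = (i, j - 1)"
    using assms(3) by (auto simp: a lattice_adj_Pair)
  then show ?thesis
    using vedge_interface[of N A "i + 1" j] vedge_interface[of N A i j]
      hedge_interface[of N A i "j + 1"] hedge_interface[of N A i j] assms(1,2)
    by cases (auto simp: a cells_def vedge_def hedge_def)
qed

lemma interface_cases:
  assumes "e \<in> interface N A"
  obtains a b where "a \<in> cells N" "b \<in> cells N" "lattice_adj a b" "e = wall a b"
    "a \<in> A" "b \<notin> A"
proof -
  from assms obtain x y where
    "e = {(x, y), (x, y + 1)} \<and> 0 < x \<and> x < N \<and> 0 \<le> y \<and> y < N \<and> ((x - 1, y) \<in> A) \<noteq> ((x, y) \<in> A)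
   \<or> e = {(x, y), (x + 1, y)} \<and> 0 \<le> x \<and> x < N \<and> 0 < y \<and> y < N \<and> ((x, y - 1) \<in> A) \<noteq> ((x, y) \<in> A)"
    unfolding interface_def by blast
  then show thesis
  proof
    assume *: "e = {(x, y), (x, y + 1)} \<and> 0 < x \<and> x < N \<and> 0 \<le> y \<and> y < N \<and> ((x - 1, y) \<in> A) \<noteq> ((x, y) \<in> A)"
    have w: "wall (x - 1, y) (x, y) = e" "wall (x, y) (x - 1, y) = e"
      using * wall_simps(1)[of "x - 1" y] by simp_all
    have c: "(x - 1, y) \<in> cells N" "(x, y) \<in> cells N" "lattice_adj (x - 1, y) (x, y)" "lattice_adj (x, y) (x - 1, y)"
      using * by (simp_all add: cells_def lattice_adj_def)
    show thesis
    proof (cases "(x, y) \<in> A")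
      case True
      then have "(x - 1, y) \<notin> A" using * by simp
      with True show thesis by (rule that[OF c(2,1,4) w(2)[symmetric]])
    next
      case False
      then have "(x - 1, y) \<in> A" using * by simp
      then show thesis using False by (rule that[OF c(1,2,3) w(1)[symmetric]])
    qed
  next
    assume *: "e = {(x, y), (x + 1, y)} \<and> 0 \<le> x \<and> x < N \<and> 0 < y \<and> y < N \<and> ((x, y - 1) \<in> A) \<noteq> ((x, y) \<in> A)"
    have w: "wall (x, y - 1) (x, y) = e" "wall (x, y) (x, y - 1) = e"
      using * wall_simps(2)[of x "y - 1"] by simp_all
    have c: "(x, y - 1) \<in> cells N" "(x, y) \<in> cells N" "lattice_adj (x, y - 1) (x, y)" "lattice_adj (x, y) (x, y - 1)"
      using * by (simp_all add: cells_def lattice_adj_def)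
    show thesis
    proof (cases "(x, y) \<in> A")
      case True
      then have "(x, y - 1) \<notin> A" using * by simp
      with True show thesis by (rule that[OF c(2,1,4) w(2)[symmetric]])
    next
      case False
      then have "(x, y - 1) \<in> A" using * by simp
      then show thesis using False by (rule that[OF c(1,2,3) w(1)[symmetric]])
    qed
  qed
qed

text \<open>Going once around a point through its four cells one changes sides an even number of times.\<close>

lemma even_inside_interface: "even_inside N (interface N A)"
  unfolding even_inside_def degree_eq[OF lattice_edges_interface] hedge_interface vedge_interface
  by (auto simp: algebra_simps)

text \<open>At most one unit edge at a border point separates two cells of the board.\<close>

lemma degree_interface_border:
  assumes "x = 0 \<or> x = N \<or> y = 0 \<or> y = N"
  shows "degree (interface N A) (x, y) \<le> 1"
  unfolding degree_eq[OF lattice_edges_interface] hedge_interface vedge_interface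
  using assms by auto

text \<open>The substitute for the Jordan curve theorem. A path inside either part never crosses
  \<open>E\<close>, so the colouring of \<open>E\<close> is constant on both parts. One edge of \<open>E\<close> shows that the
  two constants differ, and then the colour changes across every edge of the interface.\<close>

lemma interface_eqI:
  assumes "A \<subseteq> cells N" "polyomino A" "polyomino (cells N - A)"
    and "E \<subseteq> interface N A" "E \<noteq> {}" "even_inside N E"
  shows "E = interface N A"
proof -
  have lat: "lattice_edges E" using lattice_edges_interface assms(4) unfolding lattice_edges_def by blast
  note flip = colour_wall[OF lat assms(6)]
  have const: "colour E u = colour E v"
    if "polyomino X" "u \<in> X" "v \<in> X" "X \<subseteq> cells N"
      "\<And>a b. a \<in> X \<Longrightarrow> b \<in> X \<Longrightarrow> (a \<in> A) = (b \<in> A)" for X u v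
  proof (rule linked_invariant)
    show "linked X u v" using that by (auto simp: polyomino_iff_linked)
    fix a b assume "a \<in> X" "b \<in> X" "lattice_adj a b"
    then show "colour E a = colour E b"
      using flip[of a b] interface_wall[of a N b A] that(4,5) assms(4) by blast
  qed
  obtain e where "e \<in> E" using assms(5) by auto
  then have "e \<in> interface N A" using assms(4) by auto
  then obtain a b where ab: "a \<in> cells N" "b \<in> cells N" "lattice_adj a b" "e = wall a b"
    "a \<in> A" "b \<notin> A" by (rule interface_cases)
  then have ne: "colour E a \<noteq> colour E b" using flip \<open>e \<in> E\<close> by auto
  have "interface N A \<subseteq> E"
  proof
    fix e' assume "e' \<in> interface N A"
    then obtain c d where cd: "c \<in> cells N" "d \<in> cells N" "lattice_adj c d" "e' = wall c d"
      "c \<in> A" "d \<notin> A" by (rule interface_cases)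
    have "colour E a = colour E c" "colour E b = colour E d"
      using const[of A a c] const[of "cells N - A" b d] assms(1-3) ab cd by auto
    then show "e' \<in> E" using ne cd flip by auto
  qed
  then show ?thesis using assms(4) by auto
qed

lemma interface_inj:
  assumes "(0, 0) \<in> A" "(0, 0) \<in> B" "A \<subseteq> cells N" "B \<subseteq> cells N" "interface N A = interface N B"
  shows "A = B"
proof -
  have "(c \<in> A) = (c \<in> B)" if "c \<in> cells N" for c
  proof -
    have "((0, 0) \<in> A \<longleftrightarrow> (0, 0) \<in> B) = (c \<in> A \<longleftrightarrow> c \<in> B)"
      using cells_linked[OF that]
      by (rule linked_invariant[where f = "\<lambda>c. c \<in> A \<longleftrightarrow> c \<in> B"])
         (use interface_wall assms(5) in metis)
    then show ?thesis using assms by simp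
  qed
  then show ?thesis using assms by blast
qed

lemma interface_nonempty:
  assumes "A \<noteq> {}" "A \<subseteq> cells N" "cells N - A \<noteq> {}"
  shows "interface N A \<noteq> {}"
proof
  assume *: "interface N A = {}"
  have "((0, 0) \<in> A) = (c \<in> A)" if "c \<in> cells N" for c
    using cells_linked[OF that]
    by (rule linked_invariant[where f = "\<lambda>c. c \<in> A"]) (use interface_wall * in \<open>metis empty_iff\<close>)
  then show False using assms by blast
qed

text \<open>An unordered dissection is represented by its part containing the corner cell.\<close>

lemma gerrymander_eq:
  assumes "L \<ge> 1"
  shows "gerrymander L = card {A. A \<subseteq> cells (2 * int L) \<and> (0, 0) \<in> A \<and> polyomino A
    \<and> polyomino (cells (2 * int L) - A) \<and> card A = 2 * L\<^sup>2}" (is "_ = card ?D")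
proof -
  let ?C = "cells (2 * int L)"
  let ?P = "{P. partition_on ?C P \<and> card P = 2 \<and> (\<forall>A\<in>P. polyomino A \<and> card A = 2 * L\<^sup>2)}"
  have C: "(0, 0) \<in> ?C" "finite ?C" "card ?C = 4 * L\<^sup>2"
    using assms by (auto simp: cells_def card_cartesian_product power2_eq_square nat_mult_distrib)
  have "inj_on (\<lambda>A. {A, ?C - A}) ?D"
  proof (rule inj_onI)
    fix A B assume AB: "A \<in> ?D" "B \<in> ?D" and "{A, ?C - A} = {B, ?C - B}"
    then have "A \<in> {B, ?C - B}" by (metis insertI1)
    moreover have "A \<noteq> ?C - B" using AB by blast
    ultimately show "A = B" by blast
  qed
  moreover have "(\<lambda>A. {A, ?C - A}) ` ?D = ?P"
  proof (intro equalityI subsetI)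
    fix P assume "P \<in> (\<lambda>A. {A, ?C - A}) ` ?D"
    then obtain A where A: "A \<in> ?D" "P = {A, ?C - A}" by auto
    then have "finite A" using C(2) finite_subset by auto
    then have "card (?C - A) = 2 * L\<^sup>2" using A C by (simp add: card_Diff_subset)
    moreover have ne: "A \<noteq> ?C - A" using A by blast
    moreover have "A \<noteq> {}" "?C - A \<noteq> {}" using A by (simp_all add: polyomino_def)
    then have "partition_on ?C P"
      using A unfolding partition_on_def disjoint_def by blast
    moreover have "card P = 2" unfolding A(2) using ne by simp
    ultimately show "P \<in> ?P" using A by simp
  next
    fix P assume P: "P \<in> ?P"
    then obtain X Y where XY: "P = {X, Y}" "X \<noteq> Y" by (auto simp: card_2_iff)
    then have "X \<inter> Y = {}" "X \<union> Y = ?C" using P by (auto simp: partition_on_def disjoint_def)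
    then have *: "?C - X = Y" "?C - Y = X" "X \<subseteq> ?C" "Y \<subseteq> ?C" by blast+
    have XD: "A \<in> ?D" if "A \<in> P" "(0, 0) \<in> A" "?C - A \<in> P" "A \<subseteq> ?C" for A
      using P that by simp
    show "P \<in> (\<lambda>A. {A, ?C - A}) ` ?D"
    proof (cases "(0, 0) \<in> X")
      case True
      then have "X \<in> ?D" using XY(1) *(1,3) by (intro XD) simp_all
      then show ?thesis using XY(1) *(1) by (intro image_eqI[of _ _ X]) simp_all
    next
      case False
      then have "(0, 0) \<in> Y" using *(1) C(1) by blast
      then have "Y \<in> ?D" using XY(1) *(2,4) by (intro XD) simp_all
      then show ?thesis using XY(1) *(2) by (intro image_eqI[of _ _ Y]) (simp_all add: insert_commute)
    qed
  qed
  ultimately have "card ?P = card ?D" using card_image[of "\<lambda>A. {A, ?C - A}" ?D] by simp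
  then show ?thesis by (simp add: gerrymander_def chessboard_eq_cells)
qed

section \<open>The interface is a walk or a cycle\<close>

text \<open>A path that cannot be prolonged at an end of even degree has a second edge there; it leads
  back to an earlier point of the path and closes a cycle.\<close>

lemma walk_end_or_cycle:
  assumes "finite I" "\<forall>e\<in>I. \<exists>u v. e = {u, v} \<and> u \<noteq> v"
    and p: "distinct p" "length p \<ge> 2" "edges p \<subseteq> I"
    and max: "\<And>w. w \<notin> set p \<Longrightarrow> \<not> edges (p @ [w]) \<subseteq> I"
    and ev: "even (degree I (last p))"
  shows "\<exists>c. distinct c \<and> length c \<ge> 3 \<and> insert {last c, hd c} (edges c) \<subseteq> I"
proof -
  obtain v p' where "p = p' @ [v]" using p(2) by (cases p rule: rev_cases) auto
  moreover obtain xs u where "p' = xs @ [u]"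
    using p(2) calculation by (cases p' rule: rev_cases) auto
  ultimately have pe: "p = xs @ [u, v]" by simp
  have uv: "{u, v} \<in> I" using p(3) pe edges_append[of "xs" "[u, v]"] by (cases xs) auto
  then have "degree I v \<ge> 1"
    using assms(1) by (auto simp: degree_def Suc_le_eq card_gt_0_iff)
  moreover have "even (degree I v)" using ev pe by simp
  ultimately have "degree I v \<ge> 2" by presburger
  then have "card {e \<in> I. v \<in> e} > card {{u, v}}" by (simp add: degree_def)
  then have "\<not> {e \<in> I. v \<in> e} \<subseteq> {{u, v}}" by (meson card_mono finite.intros leD)
  then obtain e where e: "e \<in> I" "v \<in> e" "e \<noteq> {u, v}" by auto
  obtain a b where ab: "e = {a, b}" "a \<noteq> b" using assms(2) e(1) by blast
  obtain w where w: "e = {v, w}" "w \<noteq> v"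
  proof (cases "v = a")
    case True
    then show ?thesis using ab that[of b] by simp
  next
    case False
    then show ?thesis using ab e(2) that[of a] by (auto simp: insert_commute)
  qed
  have "w \<noteq> u" using w e by (auto simp: insert_commute)
  have "w \<in> set p"
  proof (rule ccontr)
    assume "w \<notin> set p"
    moreover have "edges (p @ [w]) = edges p \<union> {{v, w}}"
      using pe by (subst edges_append) auto
    ultimately show False using max[of w] p(3) e w by auto
  qed
  then obtain ys zs where yz: "p = ys @ w # zs" by (meson split_list)
  have "zs \<noteq> []" using yz pe w(2) by auto
  have "tl zs \<noteq> []"
  proof
    assume "tl zs = []"
    then obtain z where "zs = [z]" using \<open>zs \<noteq> []\<close> by (cases zs) auto
    then have "p = ys @ [w, z]" using yz by simp
    then show False using pe \<open>w \<noteq> u\<close> by simp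
  qed
  have "last (w # zs) = last p" unfolding yz by simp
  then have "last (w # zs) = v" using pe by simp
  moreover have "edges (w # zs) \<subseteq> edges p"
    unfolding yz by (cases "ys = []") (auto simp: edges_append)
  moreover have "length (w # zs) \<ge> 3" using \<open>zs \<noteq> []\<close> \<open>tl zs \<noteq> []\<close>
    by (cases zs; cases "tl zs") auto
  ultimately show ?thesis using p e w yz
    by (intro exI[of _ "w # zs"]) auto
qed

lemma border_walk_or_cycle:
  assumes "finite I" "I \<noteq> {}" "\<forall>e\<in>I. \<exists>u v. e = {u, v} \<and> u \<noteq> v"
    and ev: "\<And>v. v \<notin> B \<Longrightarrow> even (degree I v)"
  obtains p where "distinct p" "length p \<ge> 2" "edges p \<subseteq> I" "hd p \<in> B" "last p \<in> B"
  | c where "distinct c" "length c \<ge> 3" "insert {last c, hd c} (edges c) \<subseteq> I"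
proof -
  note walk = that(1) and cyc = that(2)
  let ?T = "{p. distinct p \<and> length p \<ge> 2 \<and> edges p \<subseteq> I}"
  have "set p \<subseteq> \<Union>I" if p: "p \<in> ?T" for p
  proof
    fix v assume "v \<in> set p"
    then obtain e where "e \<in> edges p" "v \<in> e" using p vertex_in_edge[of v p] by blast
    then show "v \<in> \<Union>I" using p by blast
  qed
  then have "?T \<subseteq> {p. set p \<subseteq> \<Union>I \<and> distinct p}" by auto
  moreover have "finite (\<Union>I)"
  proof (rule finite_Union[OF assms(1)])
    fix e assume "e \<in> I"
    then obtain u v where "e = {u, v}" using assms(3) by blast
    then show "finite e" by simp
  qed
  ultimately have fin: "finite ?T" by (rule finite_subset[OF _ finite_subset_distinct])
  obtain e where "e \<in> I" using assms(2) by auto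
  moreover obtain u v where "e = {u, v}" "u \<noteq> v" using assms(3) \<open>e \<in> I\<close> by blast
  ultimately have "[u, v] \<in> ?T" by auto
  then have "length ` ?T \<noteq> {}" by blast
  then have "Max (length ` ?T) \<in> length ` ?T" by (intro Max_in finite_imageI fin)
  then obtain p where "p \<in> ?T" "length p = Max (length ` ?T)" by fastforce
  then have p: "p \<in> ?T" "\<And>q. q \<in> ?T \<Longrightarrow> length q \<le> length p"
    using fin by simp_all
  have ends: thesis if q: "q \<in> ?T" "length q = length p" "last q \<notin> B" for q
  proof -
    have "\<exists>c. distinct c \<and> length c \<ge> 3 \<and> insert {last c, hd c} (edges c) \<subseteq> I"
    proof (rule walk_end_or_cycle[OF assms(1,3)])
      show "\<not> edges (q @ [w]) \<subseteq> I" if "w \<notin> set q" for w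
        using p(2)[of "q @ [w]"] q that by auto
    qed (use q ev in auto)
    then show thesis using cyc by blast
  qed
  show thesis
  proof (cases "last p \<in> B \<and> hd p \<in> B")
    case True
    then show thesis using p(1) walk by auto
  next
    case False
    then show thesis using ends[of p] ends[of "rev p"] p(1)
      by (auto simp: edges_rev last_rev)
  qed
qed

lemma closing_edge_notin:
  assumes "distinct c" "length c \<ge> 3"
  shows "{last c, hd c} \<notin> edges c"
proof -
  obtain a b d zs where c: "c = a # b # d # zs"
    using assms(2) by (cases c; cases "tl c"; cases "tl (tl c)") auto
  then have "{last c, a} \<notin> edges (b # d # zs)"
    using assms(1) edges_subset[of "{last c, a}" "b # d # zs"] by auto
  moreover have "last c \<noteq> b" using c assms(1) by auto
  moreover have "last c \<noteq> a" using c assms(1) by auto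
  ultimately show ?thesis using c by (auto simp: doubleton_eq_iff)
qed

lemma even_degree_cycle:
  assumes "distinct c" "length c \<ge> 3"
  shows "even (degree (insert {last c, hd c} (edges c)) w)"
proof -
  obtain a b zs where "c = a # b # zs" using assms(2) by (cases c; cases "tl c") auto
  then have "last c \<noteq> hd c" using assms(1) last_in_set[of "b # zs"] by force
  then have "of_bool (w \<in> {last c, hd c}) = of_bool (w = hd c) + (of_bool (w = last c) :: nat)"
    by auto
  then have "degree (insert {last c, hd c} (edges c)) w =
      degree (edges c) w + of_bool (w = hd c) + of_bool (w = last c)"
    using degree_insert[OF finite_edges closing_edge_notin[OF assms], of w] by simp
  moreover have "c \<noteq> []" using assms(2) by auto
  ultimately show ?thesis using even_degree_edges[of c w] assms(1) by simp
qed

text \<open>Rotating the list makes any given edge of a cycle the closing one.\<close>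

lemma cycle_open:
  assumes "distinct c" "length c \<ge> 3" "e \<in> insert {last c, hd c} (edges c)"
  obtains q where "distinct q" "set q = set c" "q \<noteq> []" "e = {last q, hd q}"
    "insert {last c, hd c} (edges c) = insert e (edges q)"
proof (cases "e = {last c, hd c}")
  case True
  moreover have "c \<noteq> []" using assms(2) by auto
  ultimately show thesis using assms(1) that[of c] by simp
next
  case False
  have "e \<in> edges c" using False assms(3) by auto
  then obtain xs ys a b where c: "c = (xs @ [a]) @ (b # ys)" "e = {a, b}"
    using edge_split[of e c] by auto
  let ?q = "(b # ys) @ (xs @ [a])"
  have "edges c = edges (xs @ [a]) \<union> edges (b # ys) \<union> {{a, b}}"
    unfolding c by (subst edges_append) auto
  moreover have "edges ?q = edges (b # ys) \<union> edges (xs @ [a]) \<union> {{last c, hd c}}"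
    unfolding c by (subst edges_append) (auto simp: hd_append)
  ultimately have "insert {last c, hd c} (edges c) = insert e (edges ?q)" using c(2) by auto
  then show thesis using that[of ?q] assms(1) c by (auto simp: insert_commute)
qed

section \<open>Leading a border-to-border walk to opposite corners\<close>

definition border :: "int \<Rightarrow> point set" where
  "border N = {(x, y). (x, y) \<in> rect N N \<and> (x = 0 \<or> x = N \<or> y = 0 \<or> y = N)}"

text \<open>The boundary points of the square \<open>[- d, K - d]\<^sup>2\<close>, listed clockwise from its lower left
  corner, which has the parameters \<open>0\<close> and \<open>4 * K\<close>; the opposite corner is at \<open>2 * K\<close>.\<close>

definition ring :: "int \<Rightarrow> int \<Rightarrow> int \<Rightarrow> point" where
  "ring d K i =
     (if i \<le> K then (- d, i - d) else if i \<le> 2 * K then (i - K - d, K - d)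
      else if i \<le> 3 * K then (K - d, 3 * K - i - d) else (4 * K - i - d, - d))"

text \<open>Leads from the boundary of \<open>[1 - d, M + d - 1]\<^sup>2\<close> one step outwards. At the corners a choice
  has to be made, and any choice keeps distinct points distinct.\<close>

definition outward :: "int \<Rightarrow> int \<Rightarrow> point \<Rightarrow> point" where
  "outward M d = (\<lambda>(x, y).
     if x = 1 - d then (x - 1, y) else if x = M + d - 1 then (x + 1, y)
     else if y = 1 - d then (x, y - 1) else (x, y + 1))"

lemma outward_adj: "lattice_adj v (outward M d v)"
  by (cases v) (simp add: outward_def lattice_adj_def)

lemma outward_border:
  assumes "v \<in> border N" "outward N 1 v = w" "outward N 2 w = u"
  obtains z where "0 \<le> z" "z \<le> N"
    "w = (-1, z) \<and> u = (-2, z) \<or> w = (N + 1, z) \<and> u = (N + 2, z) \<or>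
     w = (z, -1) \<and> u = (z, -2) \<or> w = (z, N + 1) \<and> u = (z, N + 2)"
proof -
  obtain x y where v: "v = (x, y)" by (cases v)
  have xy: "0 \<le> x" "x \<le> N" "0 \<le> y" "y \<le> N" "x = 0 \<or> x = N \<or> y = 0 \<or> y = N"
    using assms(1) by (auto simp: v border_def)
  consider "x = 0" | "x \<noteq> 0" "x = N" | "x \<noteq> 0" "x \<noteq> N" "y = 0"
    | "x \<noteq> 0" "x \<noteq> N" "y \<noteq> 0" "y = N" using xy(5) by blast
  then show thesis
  proof cases
    case 1
    then have "w = (-1, y)" using assms(2) by (simp add: v outward_def)
    moreover from this have "u = (-2, y)" using assms(3) by (simp add: outward_def)
    ultimately show thesis using that[of y] xy by simp
  next
    case 2
    then have "w = (N + 1, y)" using assms(2) by (simp add: v outward_def)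
    moreover from this have "u = (N + 2, y)" using assms(3) xy by (simp add: outward_def add.commute)
    ultimately show thesis using that[of y] xy by blast
  next
    case 3
    then have "w = (x, -1)" using assms(2) by (simp add: v outward_def)
    moreover from this have "u = (x, -2)" using assms(3) xy by (simp add: outward_def)
    ultimately show thesis using that[of x] xy by simp
  next
    case 4
    then have "w = (x, N + 1)" using assms(2) by (simp add: v outward_def)
    moreover from this have "u = (x, N + 2)" using assms(3) xy by (simp add: outward_def add.commute)
    ultimately show thesis using that[of x] xy by simp
  qed
qed

lemma ring_adj: "0 \<le> i \<Longrightarrow> i < 4 * K \<Longrightarrow> lattice_adj (ring d K i) (ring d K (i + 1))"
  by (auto simp: ring_def lattice_adj_def)

lemma ring_inj:
  "0 \<le> i \<Longrightarrow> i \<le> 4 * K \<Longrightarrow> 0 < j \<Longrightarrow> j < 4 * K \<Longrightarrow> ring d K i = ring d K j \<Longrightarrow> i = j"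
  by (auto simp: ring_def split: if_splits)

lemma ring_onto:
  assumes "- d \<le> x" "x \<le> K - d" "- d \<le> y" "y \<le> K - d"
    "x = - d \<or> x = K - d \<or> y = - d \<or> y = K - d" "K > 0"
  obtains i where "0 \<le> i" "i < 4 * K" "(x, y) = ring d K i"
proof -
  consider "x = - d" | "x \<noteq> - d" "y = K - d" | "x \<noteq> - d" "y \<noteq> K - d" "x = K - d"
    | "x \<noteq> - d" "y \<noteq> K - d" "x \<noteq> K - d" "y = - d"
    using assms(5) by blast
  then show thesis
  proof cases
    case 1
    then show thesis using assms that[of "y + d"] by (auto simp: ring_def)
  next
    case 2
    then show thesis using assms that[of "x + K + d"] by (auto simp: ring_def)
  next
    case 3
    then show thesis using assms that[of "3 * K - y - d"] by (auto simp: ring_def)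
  next
    case 4
    then show thesis using assms that[of "4 * K - x - d"] by (auto simp: ring_def)
  qed
qed

lemma ring_linked:
  assumes "0 \<le> i" "i \<le> j" "j \<le> 4 * K"
  shows "linked (ring d K ` {i..j}) (ring d K i) (ring d K j)"
  by (rule linked_along) (use assms in \<open>auto intro: ring_adj\<close>)

lemma ring_range:
  "0 \<le> i \<Longrightarrow> i \<le> 4 * K \<Longrightarrow> ring d K i = (x, y) \<Longrightarrow>
    - d \<le> x \<and> x \<le> K - d \<and> - d \<le> y \<and> y \<le> K - d \<and> (x = - d \<or> x = K - d \<or> y = - d \<or> y = K - d)"
  by (auto simp: ring_def split: if_splits)

text \<open>Both ends step out to the first ring. The start runs along the first ring to its lower left
  corner, in the direction that avoids the exit of the end, and on to \<open>(-2, -2)\<close>. The end steps out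
  further to the second ring and runs along it to \<open>(N + 2, N + 2)\<close>, away from the points
  \<open>(-2, -2)\<close> and \<open>(-2, -1)\<close> that the start needs.\<close>

lemma border_walks_le:
  assumes N: "N \<ge> 0" and st: "s \<in> border N" "t \<in> border N" "s \<noteq> t"
  shows "card (walks (rect N N) s t) \<le> crossings (N + 4) (N + 4)"
proof -
  obtain sx sy tx ty where s: "s = (sx, sy)" and t: "t = (tx, ty)" by (cases s; cases t)
  obtain s1x s1y t1x t1y where s1: "outward N 1 s = (s1x, s1y)" and t1: "outward N 1 t = (t1x, t1y)"
    by (cases "outward N 1 s"; cases "outward N 1 t")
  obtain t2x t2y where t2: "outward N 2 (t1x, t1y) = (t2x, t2y)"
    by (cases "outward N 2 (t1x, t1y)")
  have ne: "(s1x, s1y) \<noteq> (t1x, t1y)"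
    using st s1 t1 N unfolding s t border_def outward_def by (auto split: if_splits)
  have adj: "lattice_adj (s1x, s1y) s" "lattice_adj t (t1x, t1y)" "lattice_adj (t1x, t1y) (t2x, t2y)"
    using outward_adj[of s N 1] outward_adj[of t N 1] outward_adj[of "(t1x, t1y)" N 2]
    unfolding s1 t1 t2 by (simp_all add: lattice_adj_sym)
  obtain s2x s2y where s2: "outward N 2 (s1x, s1y) = (s2x, s2y)"
    by (cases "outward N 2 (s1x, s1y)")
  obtain zs where zs: "0 \<le> zs" "zs \<le> N"
    "(s1x, s1y) = (-1, zs) \<or> (s1x, s1y) = (N + 1, zs) \<or> (s1x, s1y) = (zs, -1) \<or> (s1x, s1y) = (zs, N + 1)"
    by (rule outward_border[OF st(1) s1 s2]) blast
  obtain zt where zt: "0 \<le> zt" "zt \<le> N"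
    "(t1x, t1y) = (-1, zt) \<and> (t2x, t2y) = (-2, zt) \<or> (t1x, t1y) = (N + 1, zt) \<and> (t2x, t2y) = (N + 2, zt) \<or>
     (t1x, t1y) = (zt, -1) \<and> (t2x, t2y) = (zt, -2) \<or> (t1x, t1y) = (zt, N + 1) \<and> (t2x, t2y) = (zt, N + 2)"
    by (rule outward_border[OF st(2) t1 t2])
  obtain i where i: "0 \<le> i" "i < 4 * (N + 2)" "(s1x, s1y) = ring 1 (N + 2) i"
    by (rule ring_onto[of 1 s1x "N + 2" s1y]) (use zs N in auto)
  obtain j where j: "0 \<le> j" "j < 4 * (N + 2)" "(t1x, t1y) = ring 1 (N + 2) j"
    by (rule ring_onto[of 1 t1x "N + 2" t1y]) (use zt N in auto)
  obtain k where k: "0 \<le> k" "k < 4 * (N + 4)" "(t2x, t2y) = ring 2 (N + 4) k"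
    by (rule ring_onto[of 2 t2x "N + 4" t2y]) (use zt N in auto)
  have "ring 1 (N + 2) 0 = (-1, -1)" using N by (simp add: ring_def)
  then have "j \<noteq> 0" using j(3) zt by auto
  then have j0: "0 < j" using j(1) by simp
  have "ring 2 (N + 4) 0 = (-2, -2)" "ring 2 (N + 4) 1 = (-2, -1)"
    "ring 2 (N + 4) (4 * (N + 4) - 1) = (-1, -2)"
    using N by (simp_all add: ring_def)
  then have "k \<noteq> 0" "k \<noteq> 1" "k \<noteq> 4 * (N + 4) - 1" using k(3) zt by auto
  then have k2: "2 \<le> k" "k \<le> 4 * (N + 4) - 2" using k(1,2) by simp_all
  let ?r1 = "ring 1 (N + 2) ` {0..4 * (N + 2)}"
  (* The connection of the start lives in ?X and that of the end in ?Y. *)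
  let ?X = "{(-2, -2), (-2, -1)} \<union> (?r1 - {(t1x, t1y)})"
  let ?Y = "insert (t1x, t1y) (ring 2 (N + 4) ` {2..4 * (N + 4) - 2})"
  have not_t1: "ring 1 (N + 2) l \<noteq> (t1x, t1y)" if "0 \<le> l" "l \<le> 4 * (N + 2)" "l \<noteq> j" for l
    using ring_inj[OF that(1,2) j0 j(2)] j(3) that(3) by metis
  have part: "ring 1 (N + 2) ` L \<subseteq> ?X" if L: "L \<subseteq> {0..4 * (N + 2)} - {j}" for L
  proof (rule image_subsetI)
    fix l assume "l \<in> L"
    then have "l \<in> {0..4 * (N + 2)}" "l \<noteq> j" using L by auto
    moreover from this have "ring 1 (N + 2) l \<noteq> (t1x, t1y)" by (intro not_t1) auto
    ultimately show "ring 1 (N + 2) l \<in> ?X" by blast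
  qed
  have corner: "ring 1 (N + 2) 0 = (-1, -1)" "ring 1 (N + 2) (4 * (N + 2)) = (-1, -1)"
    using N by (auto simp: ring_def)
  have ij: "i \<noteq> j" using ne i j by auto
  have "linked ?X (-1, -1) (s1x, s1y)"
  proof (cases "i < j")
    case True
    have "linked (ring 1 (N + 2) ` {0..i}) (ring 1 (N + 2) 0) (ring 1 (N + 2) i)"
      by (rule ring_linked) (use i in auto)
    then have "linked ?X (ring 1 (N + 2) 0) (ring 1 (N + 2) i)"
      by (rule linked_mono) (rule part, use i True in auto)
    then show ?thesis unfolding corner(1) i(3) .
  next
    case False
    have "linked (ring 1 (N + 2) ` {i..4 * (N + 2)}) (ring 1 (N + 2) i) (ring 1 (N + 2) (4 * (N + 2)))"
      by (rule ring_linked) (use i in auto)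
    then have "linked ?X (ring 1 (N + 2) i) (ring 1 (N + 2) (4 * (N + 2)))"
      by (rule linked_mono) (rule part, use i False ij in auto)
    then show ?thesis using corner(2) i(3) by (metis linked_sym)
  qed
  moreover have "linked ?X (-2, -2) (-2, -1)" by (rule linked_adj) (auto simp: lattice_adj_def)
  moreover have "(-1, -1) \<in> ?r1 - {(t1x, t1y)}"
    using not_t1[of 0] corner j0 N by (force simp: image_iff)
  then have "linked ?X (-2, -1) (-1, -1)" by (intro linked_adj) (auto simp: lattice_adj_def)
  ultimately have X: "linked ?X (-2, -2) (s1x, s1y)" using linked_trans by blast
  have half: "ring 2 (N + 4) (2 * (N + 4)) = (N + 2, N + 2)"
    using N by (auto simp: ring_def)
  have "linked ?Y (t2x, t2y) (N + 2, N + 2)"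
  proof (cases "k \<le> 2 * (N + 4)")
    case True
    have "linked (ring 2 (N + 4) ` {k..2 * (N + 4)}) (ring 2 (N + 4) k) (ring 2 (N + 4) (2 * (N + 4)))"
      by (rule ring_linked) (use k True N in auto)
    then have "linked ?Y (ring 2 (N + 4) k) (ring 2 (N + 4) (2 * (N + 4)))"
      by (rule linked_mono) (intro subset_insertI2 image_mono, use k2 True N in auto)
    then show ?thesis unfolding half k(3) .
  next
    case False
    have "linked (ring 2 (N + 4) ` {2 * (N + 4)..k}) (ring 2 (N + 4) (2 * (N + 4))) (ring 2 (N + 4) k)"
      by (rule ring_linked) (use k False N in auto)
    then have "linked ?Y (ring 2 (N + 4) (2 * (N + 4))) (ring 2 (N + 4) k)"
      by (rule linked_mono) (intro subset_insertI2 image_mono, use k2 False N in auto)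
    then show ?thesis using half k(3) by (metis linked_sym)
  qed
  moreover have "linked ?Y (t1x, t1y) (t2x, t2y)"
    by (rule linked_adj) (use k k2 adj in auto)
  ultimately have Y: "linked ?Y (t1x, t1y) (N + 2, N + 2)" using linked_trans by blast
  have r1: "- 1 \<le> x \<and> x \<le> N + 1 \<and> - 1 \<le> y \<and> y \<le> N + 1 \<and> (x = - 1 \<or> x = N + 1 \<or> y = - 1 \<or> y = N + 1)"
    if xy: "(x, y) \<in> ?r1" for x y
  proof -
    obtain l where "0 \<le> l" "l \<le> 4 * (N + 2)" "ring 1 (N + 2) l = (x, y)" using xy by force
    moreover have "N + 2 - 1 = N + 1" by simp
    ultimately show ?thesis using ring_range[of l "N + 2" 1 x y] by metis
  qed
  have r2: "- 2 \<le> x \<and> x \<le> N + 2 \<and> - 2 \<le> y \<and> y \<le> N + 2 \<and> (x = - 2 \<or> x = N + 2 \<or> y = - 2 \<or> y = N + 2)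
      \<and> (x, y) \<noteq> (-2, -2) \<and> (x, y) \<noteq> (-2, -1)"
    if xy: "(x, y) \<in> ring 2 (N + 4) ` {2..4 * (N + 4) - 2}" for x y
  proof -
    obtain l where l: "2 \<le> l" "l \<le> 4 * (N + 4) - 2" "ring 2 (N + 4) l = (x, y)" using xy by force
    have "ring 2 (N + 4) 0 = (-2, -2)" "ring 2 (N + 4) 1 = (-2, -1)" using N by (auto simp: ring_def)
    then have "(x, y) \<noteq> (-2, -2)" "(x, y) \<noteq> (-2, -1)"
      using ring_inj[of 0 "N + 4" l 2] ring_inj[of 1 "N + 4" l 2] l N by auto
    moreover have "0 \<le> l" "l \<le> 4 * (N + 4)" "N + 4 - 2 = N + 2" using l by simp_all
    ultimately show ?thesis using ring_range[of l "N + 4" 2 x y] l(3) by metis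
  qed
  have t1r: "(t1x, t1y) \<in> ?r1" using j by auto
  have X_cases: "(x, y) = (-2, -2) \<or> (x, y) = (-2, -1) \<or>
      (x, y) \<noteq> (t1x, t1y) \<and> - 1 \<le> x \<and> x \<le> N + 1 \<and> - 1 \<le> y \<and> y \<le> N + 1
        \<and> (x = - 1 \<or> x = N + 1 \<or> y = - 1 \<or> y = N + 1)" if "(x, y) \<in> ?X" for x y
    using that r1[of x y] by blast
  have Y_cases: "(x, y) = (t1x, t1y) \<or>
      - 2 \<le> x \<and> x \<le> N + 2 \<and> - 2 \<le> y \<and> y \<le> N + 2 \<and> (x = - 2 \<or> x = N + 2 \<or> y = - 2 \<or> y = N + 2)
      \<and> (x, y) \<noteq> (-2, -2) \<and> (x, y) \<noteq> (-2, -1)" if "(x, y) \<in> ?Y" for x y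
    using that r2[of x y] by blast
  have disj1: "(x, y) \<notin> rect N N" if "(x, y) \<in> ?X" for x y
    using X_cases[OF that] by auto
  have disj2: "(x, y) \<notin> ?X" if "(x, y) \<in> ?Y" for x y
  proof
    assume "(x, y) \<in> ?X"
    note X = X_cases[OF this]
    show False
    proof (cases "(x, y) = (t1x, t1y)")
      case True
      then show False using X r1[OF t1r] by auto
    next
      case False
      then have Y: "- 2 \<le> x" "x \<le> N + 2" "- 2 \<le> y" "y \<le> N + 2"
        "x = - 2 \<or> x = N + 2 \<or> y = - 2 \<or> y = N + 2" "(x, y) \<noteq> (-2, -2)" "(x, y) \<noteq> (-2, -1)"
        using Y_cases[OF that] by blast+
      then have "- 1 \<le> x" "x \<le> N + 1" "- 1 \<le> y" "y \<le> N + 1" using X by blast+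
      then show False using Y(5) by linarith
    qed
  qed
  have disj3: "(x, y) \<notin> rect N N" if "(x, y) \<in> ?Y" for x y
  proof (cases "(x, y) = (t1x, t1y)")
    case True
    then show ?thesis using zt by auto
  next
    case False
    then have "x = - 2 \<or> x = N + 2 \<or> y = - 2 \<or> y = N + 2" using Y_cases[OF that] by blast
    then show ?thesis by auto
  qed
  have disj: "?X \<inter> rect N N = {}" "(?X \<union> rect N N) \<inter> ?Y = {}"
  proof -
    show "?X \<inter> rect N N = {}" by (rule equals0I, elim IntE) (metis disj1 surj_pair)
    show "(?X \<union> rect N N) \<inter> ?Y = {}"
      by (rule equals0I, elim IntE UnE[of _ ?X]) (metis disj2 surj_pair, metis disj3 surj_pair)
  qed
  have subX: "- 2 \<le> x \<and> x \<le> N + 2 \<and> - 2 \<le> y \<and> y \<le> N + 2" if xy: "(x, y) \<in> ?X" for x y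
  proof -
    consider "x = -2" "y = -2" | "x = -2" "y = -1"
      | "- 1 \<le> x" "x \<le> N + 1" "- 1 \<le> y" "y \<le> N + 1"
      using X_cases[OF xy] by blast
    then show ?thesis using N by cases simp_all
  qed
  have subY: "- 2 \<le> x \<and> x \<le> N + 2 \<and> - 2 \<le> y \<and> y \<le> N + 2" if "(x, y) \<in> ?Y" for x y
  proof (cases "(x, y) = (t1x, t1y)")
    case True
    then show ?thesis using zt by auto
  next
    case False
    then show ?thesis using Y_cases[OF that] by blast
  qed
  have sub: "?X \<union> rect N N \<union> ?Y \<subseteq> {-2..N + 2} \<times> {-2..N + 2}"
  proof
    fix v assume "v \<in> ?X \<union> rect N N \<union> ?Y"
    then consider "v \<in> ?X" | "v \<in> rect N N" | "v \<in> ?Y" by blast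
    then show "v \<in> {-2..N + 2} \<times> {-2..N + 2}"
    proof cases
      case 1
      then show ?thesis using subX[of "fst v" "snd v"] by (simp add: mem_Times_iff)
    next
      case 2
      then show ?thesis by auto
    next
      case 3
      then show ?thesis using subY[of "fst v" "snd v"] by (simp add: mem_Times_iff)
    qed
  qed
  have "card (walks (rect N N) s t) \<le> card (walks ?X (-2, -2) (s1x, s1y)) * card (walks (rect N N) s t)"
    using card_walks_pos[OF X] by simp
  also have "\<dots> \<le> card (walks (?X \<union> rect N N) (-2, -2) t)"
    by (rule card_walks_append) (use disj adj in auto)
  also have "\<dots> \<le> card (walks (?X \<union> rect N N) (-2, -2) t) * card (walks ?Y (t1x, t1y) (N + 2, N + 2))"
    using card_walks_pos[OF Y] by simp
  also have "\<dots> \<le> card (walks (?X \<union> rect N N \<union> ?Y) (-2, -2) (N + 2, N + 2))"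
    by (rule card_walks_append) (use disj adj in auto)
  also have "\<dots> \<le> card (walks ({-2..N + 2} \<times> {-2..N + 2}) (-2, -2) (N + 2, N + 2))"
    by (rule card_walks_mono[OF sub]) auto
  also have "{-2..N + 2} \<times> {-2..N + 2} = (\<lambda>(x, y). (x - 2, y - 2)) ` rect (N + 4) (N + 4)"
  proof (intro equalityI subsetI)
    fix v assume "v \<in> {-2..N + 2} \<times> {-2..N + 2}"
    then show "v \<in> (\<lambda>(x, y). (x - 2, y - 2)) ` rect (N + 4) (N + 4)"
      by (intro image_eqI[of _ _ "(fst v + 2, snd v + 2)"]) auto
  qed auto
  also have "card (walks \<dots> (-2, -2) (N + 2, N + 2)) = crossings (N + 4) (N + 4)"
    unfolding crossings_def
    by (rule card_walks_image) (auto simp: lattice_adj_def inj_def)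
  finally show ?thesis .
qed

section \<open>The upper bound\<close>

lemma edges_walks:
  assumes "distinct p" "p \<noteq> []" "edges p \<subseteq> I" "lattice_edges I" "set p \<subseteq> S"
  shows "p \<in> walks S (hd p) (last p)"
proof -
  have "successively (\<lambda>u v. {u, v} \<in> I) p" using assms(3) by (simp add: edges_in_relation)
  moreover have "lattice_adj u v" if uv: "{u, v} \<in> I" for u v
  proof -
    obtain a b where ab: "{u, v} = {a, b}" "lattice_adj a b"
      using assms(4) uv unfolding lattice_edges_def by blast
    then have "u = a \<and> v = b \<or> u = b \<and> v = a" by (simp add: doubleton_eq_iff)
    then show ?thesis using ab(2) lattice_adj_sym by metis
  qed
  ultimately have "successively lattice_adj p" by (rule successively_mono)
  then show ?thesis using assms by (simp add: walks_def self_avoiding_walk_def)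
qed

text \<open>In the second case the cycle is opened at a horizontal edge of its top row, so that nothing
  lies above the two ends. Such an edge exists: a point of the top row has at least two edges, and none
  of them goes up.\<close>

lemma interface_is_walk_or_cycle:
  assumes A: "A \<subseteq> cells N" "polyomino A" "polyomino (cells N - A)" and N: "N > 0"
  obtains s t p where "s \<in> border N" "t \<in> border N" "s \<noteq> t" "p \<in> walks (rect N N) s t"
      "interface N A = edges p"
  | x y x' q where "0 \<le> x" "x \<le> N" "0 \<le> x'" "x' \<le> N" "x \<noteq> x'" "0 \<le> y" "y < N"
      "q \<in> walks ({0..N} \<times> {0..y}) (x, y) (x', y)"
      "interface N A = insert {(x, y), (x', y)} (edges q)"
proof -
  note walk = that(1) and cyc = that(2)
  let ?I = "interface N A"
  have ne: "?I \<noteq> {}" using A by (intro interface_nonempty) (auto simp: polyomino_def)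
  have doubleton: "\<forall>e\<in>?I. \<exists>u v. e = {u, v} \<and> u \<noteq> v"
  proof
    fix e assume "e \<in> ?I"
    then obtain u v where "e = {u, v}" "lattice_adj u v"
      using lattice_edges_interface unfolding lattice_edges_def by blast
    moreover from this have "u \<noteq> v" by (auto simp: lattice_adj_def)
    ultimately show "\<exists>u v. e = {u, v} \<and> u \<noteq> v" by blast
  qed
  have rect: "set p \<subseteq> rect N N" if p: "edges p \<subseteq> ?I" "length p \<ge> 2" for p
  proof
    fix v assume "v \<in> set p"
    then obtain e where "e \<in> edges p" "v \<in> e" using vertex_in_edge[of v p] p(2) by blast
    then show "v \<in> rect N N" using p(1) interface_subset_box by blast
  qed
  have even: "even (degree ?I v)" if "v \<notin> border N" for v
  proof (cases "v \<in> rect N N")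
    case True
    then show ?thesis using that even_inside_interface[of N A]
      by (cases v) (auto simp: border_def even_inside_def)
  next
    case False
    then have "{e \<in> ?I. v \<in> e} = {}" using interface_subset_box by blast
    then have "card {e \<in> ?I. v \<in> e} = 0" by (simp only: card.empty)
    then show ?thesis by (simp add: degree_def)
  qed
  show thesis
  proof (rule border_walk_or_cycle[OF finite_interface ne doubleton even])
    fix p assume p: "distinct p" "2 \<le> length p" "edges p \<subseteq> ?I" "hd p \<in> border N" "last p \<in> border N"
    have pne: "p \<noteq> []" "edges p \<noteq> {}" using p(2) by (auto simp: Suc_le_length_iff numeral_2_eq_2)
    have "even_inside N (edges p)"
      unfolding even_inside_def
    proof (intro allI impI)
      fix x y assume "0 < x \<and> x < N \<and> 0 < y \<and> y < N"
      then have "(x, y) \<noteq> hd p" "(x, y) \<noteq> last p" using p(4,5) by (auto simp: border_def)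
      then show "even (degree (edges p) (x, y))" using even_degree_edges[OF p(1) pne(1), of "(x, y)"] by simp
    qed
    then have "?I = edges p" using interface_eqI[OF A p(3) pne(2)] by simp
    moreover have "hd p \<noteq> last p"
      using p(1,2) by (cases p) (auto simp: last_in_set dest: last_in_set split: if_splits)
    moreover have "p \<in> walks (rect N N) (hd p) (last p)"
      by (rule edges_walks[OF p(1) pne(1) p(3) lattice_edges_interface rect[OF p(3,2)]])
    ultimately show thesis using walk p(4,5) by blast
  next
    fix c assume c: "distinct c" "3 \<le> length c" "insert {last c, hd c} (edges c) \<subseteq> ?I"
    let ?E = "insert {last c, hd c} (edges c)"
    have "even_inside N ?E" using even_degree_cycle[OF c(1,2)] by (simp add: even_inside_def)
    then have IE: "?E = ?I" using interface_eqI[OF A c(3)] by simp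
    have lat: "lattice_edges ?E" using IE lattice_edges_interface by simp
    have deg: "degree ?E v \<ge> 2" if v: "v \<in> set c" for v
    proof -
      obtain e where "e \<in> edges c" "v \<in> e" using vertex_in_edge[OF v] c(2) by auto
      then have "{x \<in> ?E. v \<in> x} \<noteq> {}" by auto
      moreover have "finite {x \<in> ?E. v \<in> x}" using finite_edges by auto
      ultimately have "degree ?E v \<noteq> 0" by (simp add: degree_def)
      moreover have "even (degree ?E v)" by (rule even_degree_cycle[OF c(1,2)])
      ultimately show ?thesis by presburger
    qed
    have cbox: "set c \<subseteq> rect N N" using rect[of c] c by auto
    have inner: "0 < x \<and> x < N \<and> 0 < y \<and> y < N" if xy: "(x, y) \<in> set c" for x y
    proof (rule ccontr)
      assume "\<not> ?thesis"
      then have "x = 0 \<or> x = N \<or> y = 0 \<or> y = N" using xy cbox by fastforce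
      then have "degree ?I (x, y) \<le> 1" by (rule degree_interface_border)
      then show False using deg[OF xy] IE by simp
    qed
    have "Max (snd ` set c) \<in> snd ` set c" using c(2) by (intro Max_in) auto
    then obtain x y where xy: "(x, y) \<in> set c" "y = Max (snd ` set c)" by force
    have top: "b \<le> y" if "(a, b) \<in> set c" for a b
      unfolding xy(2) using that by (intro Max_ge) force+
    have inC: "e \<subseteq> set c" if "e \<in> ?E" for e
      using that edges_subset[of e c] c(2) by (cases "c = []") auto
    (* A vertical edge above the top row would lead to a higher point of the cycle. *)
    have "\<not> vedge ?E x y"
      using inC[of "{(x, y), (x, y + 1)}"] top[of x "y + 1"] by (auto simp: vedge_def)
    then have "hedge ?E (x - 1) y \<or> hedge ?E x y"
      using deg[OF xy(1)] unfolding degree_eq[OF lat] by (auto simp: of_bool_def split: if_splits)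
    moreover have flip: "{(x - 1, y), (x - 1 + 1, y)} = {(x, y), (x - 1, y)}" by auto
    ultimately have "{(x, y), (x - 1, y)} \<in> ?E \<or> {(x, y), (x + 1, y)} \<in> ?E"
      by (simp only: hedge_def flip)
    moreover have "x - 1 \<noteq> x" "x + 1 \<noteq> x" by simp_all
    ultimately obtain x' where x': "{(x, y), (x', y)} \<in> ?E" "x' \<noteq> x" by blast
    then have x'c: "(x', y) \<in> set c" using inC by blast
    obtain q where q: "distinct q" "set q = set c" "q \<noteq> []" "{(x, y), (x', y)} = {last q, hd q}"
      "?E = insert {(x, y), (x', y)} (edges q)"
      by (rule cycle_open[OF c(1,2) x'(1)])
    have "edges q \<subseteq> ?I" using q(5) IE by blast
    moreover have "set q \<subseteq> {0..N} \<times> {0..y}"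
    proof
      fix v assume "v \<in> set q"
      moreover obtain a b where "v = (a, b)" by (cases v)
      ultimately have "v = (a, b)" "(a, b) \<in> set c" using q(2) by simp_all
      then show "v \<in> {0..N} \<times> {0..y}" using inner[of a b] top[of a b] by auto
    qed
    ultimately have qw: "q \<in> walks ({0..N} \<times> {0..y}) (hd q) (last q)"
      by (rule edges_walks[OF q(1,3) _ lattice_edges_interface])
    have "hd q = (x, y) \<and> last q = (x', y) \<or> hd q = (x', y) \<and> last q = (x, y)"
      using q(4) unfolding doubleton_eq_iff by metis
    then show thesis
    proof
      assume "hd q = (x, y) \<and> last q = (x', y)"
      then show thesis using cyc[of x x' y q] qw q(5) IE inner[OF xy(1)] inner[OF x'c] x'(2) by simp
    next
      assume "hd q = (x', y) \<and> last q = (x, y)"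
      then show thesis using cyc[of x' x y q] qw q(5) IE inner[OF xy(1)] inner[OF x'c] x'(2)
        by (simp add: insert_commute)
    qed
  qed
qed

text \<open>The two vertical rays from the ends to the upper border are free, as the walk stays below them.\<close>

lemma cycle_walks_le:
  assumes "0 \<le> x" "x \<le> N" "0 \<le> x'" "x' \<le> N" "x \<noteq> x'" "0 \<le> y" "y < N"
  shows "card (walks ({0..N} \<times> {0..y}) (x, y) (x', y)) \<le> crossings (N + 4) (N + 4)"
proof -
  let ?ray = "\<lambda>x. {x} \<times> {y + 1..N}"
  have ray: "linked (?ray x) (x, y + 1) (x, N)" for x
    using linked_along[of "y + 1" N "\<lambda>k. (x, k)" "?ray x"] assms by (auto simp: lattice_adj_def)
  have "card (walks ({0..N} \<times> {0..y}) (x, y) (x', y)) \<le>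
      card (walks (?ray x) (x, N) (x, y + 1)) * card (walks ({0..N} \<times> {0..y}) (x, y) (x', y))"
    using card_walks_pos[OF linked_sym[OF ray[of x]]] assms by simp
  also have "\<dots> \<le> card (walks (?ray x \<union> {0..N} \<times> {0..y}) (x, N) (x', y))"
    by (rule card_walks_append) (auto simp: lattice_adj_def)
  also have "\<dots> \<le> card (walks (?ray x \<union> {0..N} \<times> {0..y}) (x, N) (x', y))
      * card (walks (?ray x') (x', y + 1) (x', N))"
    using card_walks_pos[OF ray[of x']] assms by simp
  also have "\<dots> \<le> card (walks (?ray x \<union> {0..N} \<times> {0..y} \<union> ?ray x') (x, N) (x', N))"
    by (rule card_walks_append) (use assms(5) in \<open>auto simp: lattice_adj_def\<close>)
  also have "\<dots> \<le> card (walks (rect N N) (x, N) (x', N))"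
    by (rule card_walks_mono) (use assms in auto)
  also have "\<dots> \<le> crossings (N + 4) (N + 4)"
    by (rule border_walks_le) (use assms in \<open>auto simp: border_def\<close>)
  finally show ?thesis .
qed

lemma card_UN_le_mult:
  assumes "finite I" "\<And>i. i \<in> I \<Longrightarrow> card (f i) \<le> k"
  shows "card (\<Union>i\<in>I. f i) \<le> card I * k"
proof -
  have "card (\<Union>i\<in>I. f i) \<le> (\<Sum>i\<in>I. card (f i))" by (rule card_UN_le[OF assms(1)])
  also have "\<dots> \<le> (\<Sum>i\<in>I. k)" by (rule sum_mono[OF assms(2)])
  finally show ?thesis by simp
qed

theorem gerrymander_le:
  assumes "L \<ge> 1"
  shows "gerrymander L \<le> 2 * (2 * L + 1) ^ 4 * card (wcas (2 * L + 4))"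
proof -
  let ?N = "2 * int L" and ?C = "card (wcas (2 * L + 4))"
  have C: "?C = crossings (?N + 4) (?N + 4)" by (simp add: wcas_eq_crossings)
  let ?D = "{A. A \<subseteq> cells ?N \<and> (0, 0) \<in> A \<and> polyomino A
    \<and> polyomino (cells ?N - A) \<and> card A = 2 * L\<^sup>2}"
  let ?ST = "{(s, t). s \<in> border ?N \<and> t \<in> border ?N \<and> s \<noteq> t}"
  let ?XY = "{((x, y), (x', y')). 0 \<le> x \<and> x \<le> ?N \<and> 0 \<le> x' \<and> x' \<le> ?N \<and> x \<noteq> x' \<and> 0 \<le> y \<and> y < ?N \<and> y' = y}"
  (* ?ST lists the ends of a border-to-border path, ?XY those of an opened cycle. *)
  let ?f = "\<lambda>(s, t). edges ` walks (rect ?N ?N) s t"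
  let ?g = "\<lambda>(v, w). (\<lambda>q. insert {v, w} (edges q)) ` walks ({0..?N} \<times> {0..snd v}) v w"
  have sub: "?ST \<subseteq> rect ?N ?N \<times> rect ?N ?N" "?XY \<subseteq> rect ?N ?N \<times> rect ?N ?N"
    by (auto simp: border_def)
  then have fin: "finite ?ST" "finite ?XY" by (auto elim!: finite_subset)
  have "card (rect ?N ?N) = (2 * L + 1) * (2 * L + 1)"
    by (simp add: nat_add_distrib nat_mult_distrib)
  then have "card (rect ?N ?N \<times> rect ?N ?N) = (2 * L + 1) ^ 4"
    unfolding card_cartesian_product[of "rect ?N ?N" "rect ?N ?N"]
    by (simp only: power4_eq_xxxx mult.assoc)
  then have cardST: "card ?ST \<le> (2 * L + 1) ^ 4" and cardXY: "card ?XY \<le> (2 * L + 1) ^ 4"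
    using card_mono[OF _ sub(1)] card_mono[OF _ sub(2)] by auto
  have "interface ?N ` ?D \<subseteq> (\<Union>i\<in>?ST. ?f i) \<union> (\<Union>i\<in>?XY. ?g i)"
  proof (rule image_subsetI)
    fix A assume "A \<in> ?D"
    then have A: "A \<subseteq> cells ?N" "polyomino A" "polyomino (cells ?N - A)" by auto
    have "?N > 0" using assms by simp
    then show "interface ?N A \<in> (\<Union>i\<in>?ST. ?f i) \<union> (\<Union>i\<in>?XY. ?g i)"
    proof (rule interface_is_walk_or_cycle[OF A])
      fix s t p assume "s \<in> border ?N" "t \<in> border ?N" "s \<noteq> t" "p \<in> walks (rect ?N ?N) s t"
        "interface ?N A = edges p"
      then have st: "(s, t) \<in> ?ST" and "interface ?N A \<in> ?f (s, t)" by auto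
      from this(2) show ?thesis by (rule UnI1[OF UN_I[OF st]])
    next
      fix x y x' q assume "0 \<le> x" "x \<le> ?N" "0 \<le> x'" "x' \<le> ?N" "x \<noteq> x'" "0 \<le> y" "y < ?N"
        and q: "q \<in> walks ({0..?N} \<times> {0..y}) (x, y) (x', y)"
          "interface ?N A = insert {(x, y), (x', y)} (edges q)"
      then have xy: "((x, y), (x', y)) \<in> ?XY" by simp
      have "interface ?N A \<in> ?g ((x, y), (x', y))"
        unfolding prod.case snd_conv using q by (intro image_eqI[where x = q])
      then show ?thesis by (rule UnI2[OF UN_I[OF xy]])
    qed
  qed
  moreover have finite_boxes: "finite (walks ({0..?N} \<times> {0..y}) v w)" for y v w
    by (rule finite_walks) auto
  then have "finite ((\<Union>i\<in>?ST. ?f i) \<union> (\<Union>i\<in>?XY. ?g i))" using fin by auto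
  moreover have "inj_on (interface ?N) ?D"
    by (rule inj_onI) (use interface_inj in blast)
  ultimately have "card ?D \<le> card ((\<Union>i\<in>?ST. ?f i) \<union> (\<Union>i\<in>?XY. ?g i))"
    by (intro card_inj_on_le)
  also have "\<dots> \<le> card (\<Union>i\<in>?ST. ?f i) + card (\<Union>i\<in>?XY. ?g i)" by (rule card_Un_le)
  also have "card (\<Union>i\<in>?ST. ?f i) \<le> card ?ST * ?C"
  proof (rule card_UN_le_mult[OF fin(1)])
    fix i assume "i \<in> ?ST"
    then obtain s t where i: "i = (s, t)" and st: "s \<in> border ?N" "t \<in> border ?N" "s \<noteq> t" by auto
    have "card (?f i) \<le> card (walks (rect ?N ?N) s t)"
      using card_image_le[OF finite_boxes] by (simp add: i)
    also have "\<dots> \<le> ?C" unfolding C by (rule border_walks_le) (use st in auto)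
    finally show "card (?f i) \<le> ?C" .
  qed
  also have "card (\<Union>i\<in>?XY. ?g i) \<le> card ?XY * ?C"
  proof (rule card_UN_le_mult[OF fin(2)])
    fix i assume "i \<in> ?XY"
    then obtain x y x' where i: "i = ((x, y), (x', y))" and
      xy: "0 \<le> x" "x \<le> ?N" "0 \<le> x'" "x' \<le> ?N" "x \<noteq> x'" "0 \<le> y" "y < ?N" by auto
    have "card (?g i) \<le> card (walks ({0..?N} \<times> {0..y}) (x, y) (x', y))"
      using card_image_le[OF finite_boxes] by (simp add: i)
    also have "\<dots> \<le> ?C" unfolding C by (rule cycle_walks_le[OF xy])
    finally show "card (?g i) \<le> ?C" .
  qed
  also have "card ?ST * ?C + card ?XY * ?C \<le> (2 * L + 1) ^ 4 * ?C + (2 * L + 1) ^ 4 * ?C"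
    using cardST cardXY by (intro add_mono mult_right_mono) auto
  finally show ?thesis using gerrymander_eq[OF assms] by simp
qed

section \<open>A walk across the board splits it into two polyominoes\<close>

text \<open>The cell on the left of a unit step; the cell on its right is the left one of the
  reversed step.\<close>

definition left_cell :: "point \<Rightarrow> point \<Rightarrow> point" where
  "left_cell = (\<lambda>(a, b) (c, d).
     if c = a + 1 then (a, b) else if c = a - 1 then (a - 1, b - 1)
     else if d = b + 1 then (a - 1, b) else (a, b - 1))"

text \<open>Reachability without crossing \<open>E\<close>. It is finer than having the same colour, and it is what the
  walk controls locally.\<close>

definition joined :: "int \<Rightarrow> point set set \<Rightarrow> point \<Rightarrow> point \<Rightarrow> bool" where
  "joined N E = (\<lambda>a b. a \<in> cells N \<and> b \<in> cells N \<and> lattice_adj a b \<and> wall a b \<notin> E)\<^sup>*\<^sup>*"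

lemma joined_refl [simp]: "joined N E a a"
  by (simp add: joined_def)

lemma joined_trans: "joined N E a b \<Longrightarrow> joined N E b c \<Longrightarrow> joined N E a c"
  unfolding joined_def by (rule rtranclp_trans)

lemma wall_commute: "wall a b = wall b a"
  by (cases a; cases b) (simp add: wall_def max.commute min.commute)

lemma joined_sym: "joined N E a b \<Longrightarrow> joined N E b a"
  unfolding joined_def
proof (induction rule: rtranclp_induct)
  case (step y z)
  then show ?case
    by (metis (mono_tags, lifting) converse_rtranclp_into_rtranclp lattice_adj_sym wall_commute)
qed auto

lemma joined_step:
  "a \<in> cells N \<Longrightarrow> b \<in> cells N \<Longrightarrow> lattice_adj a b \<Longrightarrow> wall a b \<notin> E \<Longrightarrow> joined N E a b"
  unfolding joined_def by auto

lemma joined_imp_linked: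
  assumes "lattice_edges E" "even_inside N E" "joined N E a b"
  shows "linked {c \<in> cells N. colour E c = colour E a} a b \<and> colour E b = colour E a"
  using assms(3) unfolding joined_def
proof (induction rule: rtranclp_induct)
  case base
  show ?case by (simp add: linked_refl)
next
  case (step y z)
  then have "colour E y = colour E z" using colour_wall[OF assms(1,2)] by blast
  then have "linked {c \<in> cells N. colour E c = colour E a} y z"
    using step by (intro linked_adj) auto
  then show ?case using step \<open>colour E y = colour E z\<close> linked_trans by blast
qed

text \<open>The left cells of two consecutive steps are connected around the common point, on the side
  that carries no edge of \<open>E\<close>. Reversing both steps gives the same for the right cells.\<close>

lemma joined_around_vertex:
  assumes v: "v = (x, y)" "0 < x" "x < N" "0 < y" "y < N"
    and adj: "lattice_adj u v" "lattice_adj v w" "u \<noteq> w"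
    and only: "\<And>z. {v, z} \<in> E \<Longrightarrow> z = u \<or> z = w"
  shows "joined N E (left_cell u v) (left_cell v w)"
proof -
  have cells: "(x, y) \<in> cells N" "(x - 1, y) \<in> cells N" "(x, y - 1) \<in> cells N"
    "(x - 1, y - 1) \<in> cells N"
    using v by (auto simp: cells_def)
  have north: "joined N E (x - 1, y) (x, y)" if "(x, y + 1) \<noteq> u" "(x, y + 1) \<noteq> w"
    using only[of "(x, y + 1)"] that cells
    by (intro joined_step) (auto simp: v(1) lattice_adj_def wall_def)
  have south: "joined N E (x - 1, y - 1) (x, y - 1)" if "(x, y - 1) \<noteq> u" "(x, y - 1) \<noteq> w"
    using only[of "(x, y - 1)"] that cells
    by (intro joined_step) (auto simp: v(1) lattice_adj_def wall_def insert_commute)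
  have west: "joined N E (x - 1, y - 1) (x - 1, y)" if "(x - 1, y) \<noteq> u" "(x - 1, y) \<noteq> w"
    using only[of "(x - 1, y)"] that cells
    by (intro joined_step) (auto simp: v(1) lattice_adj_def wall_def insert_commute)
  have east: "joined N E (x, y - 1) (x, y)" if "(x + 1, y) \<noteq> u" "(x + 1, y) \<noteq> w"
    using only[of "(x + 1, y)"] that cells
    by (intro joined_step) (auto simp: v(1) lattice_adj_def wall_def insert_commute)
  have u: "u = (x + 1, y) \<or> u = (x - 1, y) \<or> u = (x, y + 1) \<or> u = (x, y - 1)"
    using adj(1) lattice_adj_sym lattice_adj_Pair unfolding v(1) by blast
  have w: "w = (x + 1, y) \<or> w = (x - 1, y) \<or> w = (x, y + 1) \<or> w = (x, y - 1)"
    using adj(2) lattice_adj_Pair unfolding v(1) by blast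
  from u show ?thesis
  proof (elim disjE)
    assume u: "u = (x + 1, y)"
    then have l: "left_cell u v = (x, y - 1)" by (simp add: left_cell_def v)
    from w adj(3) u consider "w = (x - 1, y)" | "w = (x, y + 1)" | "w = (x, y - 1)" by blast
    then show ?thesis unfolding l
      by cases (use north south west east u in \<open>auto simp: left_cell_def v(1) intro: joined_trans joined_sym\<close>)
  next
    assume u: "u = (x - 1, y)"
    then have l: "left_cell u v = (x - 1, y)" by (simp add: left_cell_def v)
    from w adj(3) u consider "w = (x + 1, y)" | "w = (x, y + 1)" | "w = (x, y - 1)" by blast
    then show ?thesis unfolding l
      by cases (use north south west east u in \<open>auto simp: left_cell_def v(1) intro: joined_trans joined_sym\<close>)
  next
    assume u: "u = (x, y + 1)"
    then have l: "left_cell u v = (x, y)" by (simp add: left_cell_def v)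
    from w adj(3) u consider "w = (x + 1, y)" | "w = (x - 1, y)" | "w = (x, y - 1)" by blast
    then show ?thesis unfolding l
      by cases (use north south west east u in \<open>auto simp: left_cell_def v(1) intro: joined_trans joined_sym\<close>)
  next
    assume u: "u = (x, y - 1)"
    then have l: "left_cell u v = (x - 1, y - 1)" by (simp add: left_cell_def v)
    from w adj(3) u consider "w = (x + 1, y)" | "w = (x - 1, y)" | "w = (x, y + 1)" by blast
    then show ?thesis unfolding l
      by cases (use north south west east u in \<open>auto simp: left_cell_def v(1) intro: joined_trans joined_sym\<close>)
  qed
qed

lemma edges_at_inner_vertex:
  assumes "distinct (xs @ u # v # w # ys)" "e \<in> edges (xs @ u # v # w # ys)" "v \<in> e"
  shows "e = {u, v} \<or> e = {v, w}"
  using assms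
proof (induction xs)
  case Nil
  then have "e \<notin> edges (w # ys)" using edges_subset[of e "w # ys"] by auto
  then show ?case using Nil by auto
next
  case (Cons x xs)
  have "e \<in> edges (xs @ u # v # w # ys)"
  proof (cases xs)
    case Nil
    then show ?thesis using Cons.prems by auto
  next
    case (Cons a as)
    then show ?thesis using Cons.prems by auto
  qed
  then show ?case using Cons by auto
qed

text \<open>A walk that enters the board at the bottom, leaves it at the top and otherwise stays in
  its interior.\<close>

locale board_crossing =
  fixes N s t :: int and W :: "point list"
  assumes s: "0 < s" "s < N" and t: "0 < t" "t < N"
    and W: "W \<in> walks ({1..N - 1} \<times> {1..N - 1} \<union> {(s, 0), (t, N)}) (s, 0) (t, N)"
begin

abbreviation "E \<equiv> edges W"

lemma dist: "distinct W" and adjW: "successively lattice_adj W" and ne: "W \<noteq> []"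
  and hdW: "hd W = (s, 0)" and lastW: "last W = (t, N)"
  and setW: "set W \<subseteq> {1..N - 1} \<times> {1..N - 1} \<union> {(s, 0), (t, N)}"
  using W by (auto simp: walks_def self_avoiding_walk_def)

lemma vertexW: "(x, y) \<in> set W \<Longrightarrow>
    0 < x \<and> x < N \<and> (0 < y \<and> y < N \<or> x = s \<and> y = 0 \<or> x = t \<and> y = N)"
  using setW s t by fastforce

lemma lattice: "lattice_edges E"
  unfolding lattice_edges_def using edges_adj[OF adjW] by blast

lemma even_inner: "even_inside N E"
  unfolding even_inside_def
proof (intro allI impI)
  fix x y assume "0 < x \<and> x < N \<and> 0 < y \<and> y < N"
  then show "even (degree E (x, y))"
    using even_degree_edges[OF dist ne, of "(x, y)"] hdW lastW by auto
qed

lemma vedge_range: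
  assumes "vedge E x y"
  shows "0 < x" "x < N" "0 \<le> y" "y < N"
proof -
  have *: "(x, y) \<in> set W" "(x, y + 1) \<in> set W"
    using assms edges_subset unfolding vedge_def by blast+
  show "0 < x" "x < N" "0 \<le> y" "y < N"
    using vertexW[OF *(1)] vertexW[OF *(2)] s by auto
qed

lemma hedge_range:
  assumes "hedge E x y"
  shows "0 < x" "x + 1 < N" "0 < y" "y < N"
proof -
  have *: "(x, y) \<in> set W" "(x + 1, y) \<in> set W"
    using assms edges_subset unfolding hedge_def by blast+
  show "0 < x" "x + 1 < N" "0 < y" "y < N"
    using vertexW[OF *(1)] vertexW[OF *(2)] s by auto
qed

lemma vedge_bottom: "vedge E x 0 \<longleftrightarrow> x = s"
proof
  assume "vedge E x 0"
  then have "(x, 0) \<in> set W" using edges_subset unfolding vedge_def by blast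
  then show "x = s" using vertexW[of x 0] s by auto
next
  assume "x = s"
  obtain e where e: "e \<in> E" "(s, 0) \<in> e"
  proof -
    have "length W \<ge> 2" using hdW lastW s ne by (cases W; cases "tl W") auto
    then show thesis using vertex_in_edge[of "(s, 0)" W] hd_in_set[OF ne] hdW that by auto
  qed
  then have "degree E (s, 0) > 0" using finite_edges by (auto simp: degree_def card_gt_0_iff)
  then have "hedge E (s - 1) 0 \<or> hedge E s 0 \<or> vedge E s (- 1) \<or> vedge E s 0"
    unfolding degree_eq[OF lattice] by (auto simp: of_bool_def split: if_splits)
  then show "vedge E x 0" using hedge_range(3) vedge_range(3) \<open>x = s\<close> by fastforce
qed

definition right_part :: "point set" where
  "right_part = {c \<in> cells N. colour E c}"

lemma interface_right_part: "interface N right_part = E"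
proof (intro equalityI subsetI)
  fix e assume "e \<in> interface N right_part"
  then obtain a b where "a \<in> cells N" "b \<in> cells N" "lattice_adj a b" "e = wall a b"
    "a \<in> right_part" "b \<notin> right_part" by (rule interface_cases)
  then show "e \<in> E" using colour_wall[OF lattice even_inner, of a b] by (simp add: right_part_def)
next
  fix e assume e: "e \<in> E"
  have ab: "e \<in> interface N right_part" if "a \<in> cells N" "b \<in> cells N" "lattice_adj a b" "e = wall a b" for a b
    using that e colour_wall[OF lattice even_inner that(1-3)] interface_wall[OF that(1-3), of right_part]
    by (auto simp: right_part_def)
  obtain u v where uv: "e = {u, v}" "lattice_adj u v" using e lattice unfolding lattice_edges_def by blast
  obtain x y where u: "u = (x, y)" by (cases u)
  from uv(2) consider "v = (x + 1, y)" | "v = (x - 1, y)" | "v = (x, y + 1)" | "v = (x, y - 1)"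
    unfolding u lattice_adj_Pair by blast
  then show "e \<in> interface N right_part"
  proof cases
    case 1
    then have h: "hedge E x y" using e uv u by (simp add: hedge_def)
    show ?thesis by (rule ab[of "(x, y - 1)" "(x, y)"])
      (use hedge_range[OF h] 1 uv u in \<open>auto simp: cells_def lattice_adj_def wall_def\<close>)
  next
    case 2
    then have h: "hedge E (x - 1) y" using e uv u by (simp add: hedge_def insert_commute)
    show ?thesis by (rule ab[of "(x - 1, y - 1)" "(x - 1, y)"])
      (use hedge_range[OF h] 2 uv u in \<open>auto simp: cells_def lattice_adj_def wall_def\<close>)
  next
    case 3
    then have h: "vedge E x y" using e uv u by (simp add: vedge_def)
    show ?thesis by (rule ab[of "(x - 1, y)" "(x, y)"])
      (use vedge_range[OF h] 3 uv u in \<open>auto simp: cells_def lattice_adj_def wall_def\<close>)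
  next
    case 4
    then have h: "vedge E x (y - 1)" using e uv u by (simp add: vedge_def insert_commute)
    show ?thesis by (rule ab[of "(x - 1, y - 1)" "(x, y - 1)"])
      (use vedge_range[OF h] 4 uv u in \<open>auto simp: cells_def lattice_adj_def wall_def\<close>)
  qed
qed

lemma second_vertex: "\<exists>ys. W = (s, 0) # (s, 1) # ys"
proof -
  obtain v ys where W': "W = (s, 0) # v # ys"
    using hdW lastW s ne by (cases W; cases "tl W") auto
  then have "lattice_adj (s, 0) v" "v \<in> set W" using adjW by auto
  then have "v = (s, 1)"
    unfolding lattice_adj_Pair using vertexW[of "s + 1" 0] vertexW[of "s - 1" 0] vertexW[of s "-1"] s by auto
  then show ?thesis using W' by blast
qed

text \<open>The cells to the left of all steps belong to one class and those to the right to another one,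
  represented by the two cells beside the first step.\<close>

lemma sides_joined:
  "W = xs @ a # b # ys \<Longrightarrow>
    joined N E (s - 1, 0) (left_cell a b) \<and> joined N E (s, 0) (left_cell b a)"
proof (induction xs arbitrary: a b ys rule: rev_induct)
  case Nil
  then have "a = (s, 0)" "b = (s, 1)" using second_vertex by auto
  then show ?case by (simp add: left_cell_def)
next
  case (snoc u xs)
  then have Wu: "W = xs @ u # a # b # ys" by simp
  then have IH: "joined N E (s - 1, 0) (left_cell u a)" "joined N E (s, 0) (left_cell a u)"
    using snoc.IH by blast+
  have adj: "lattice_adj u a" "lattice_adj a b" using adjW unfolding Wu successively_append_iff by auto
  have "u \<noteq> b" using dist unfolding Wu by auto
  have only: "z = u \<or> z = b" if "{a, z} \<in> E" for z
  proof -
    have "{a, z} = {u, a} \<or> {a, z} = {a, b}"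
      by (rule edges_at_inner_vertex[of xs u a b ys]) (use that dist Wu in auto)
    then show ?thesis by (auto simp: doubleton_eq_iff)
  qed
  obtain x y where xy: "a = (x, y)" by (cases a)
  have "a \<noteq> hd W" using dist unfolding Wu by (cases xs) auto
  moreover have "a \<noteq> last W"
  proof -
    have "last W \<in> set (b # ys)" unfolding Wu by simp
    then show ?thesis using dist unfolding Wu by auto
  qed
  moreover have "a \<in> set W" unfolding Wu by simp
  ultimately have inner: "0 < x" "x < N" "0 < y" "y < N"
    using vertexW[of x y] hdW lastW xy by auto
  have "joined N E (left_cell u a) (left_cell a b)"
    using only by (intro joined_around_vertex[OF xy inner adj \<open>u \<noteq> b\<close>]) blast
  moreover have "joined N E (left_cell b a) (left_cell a u)"
    using only adj lattice_adj_sym \<open>u \<noteq> b\<close>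
    by (intro joined_around_vertex[OF xy inner]) blast+
  ultimately show ?case using joined_trans[OF IH(1)] joined_trans[OF IH(2) joined_sym] by simp
qed

lemma joined_bottom: "joined N E (0, 0) (s - 1, 0)"
proof -
  have "joined N E (0, 0) (i, 0)" if "0 \<le> i" "i < s" for i
    using that
  proof (induction i rule: int_ge_induct)
    case (step i)
    have "joined N E (i, 0) (i + 1, 0)"
      by (rule joined_step) (use step s vedge_bottom[of "i + 1"] in \<open>auto simp: cells_def lattice_adj_def vedge_def\<close>)
    moreover have "joined N E (0, 0) (i, 0)" using step by simp
    ultimately show ?case using joined_trans by metis
  qed simp
  then show ?thesis using s by simp
qed

text \<open>From any cell go left until a step of the walk blocks the way, which identifies the side, or
  until the first column, which is on the left side.\<close>

lemma joined_side:
  assumes "(i, j) \<in> cells N"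
  shows "joined N E (s - 1, 0) (i, j) \<or> joined N E (s, 0) (i, j)"
proof -
  have ij: "0 \<le> i" "i < N" "0 \<le> j" "j < N" using assms by (auto simp: cells_def)
  have column: "joined N E (0, 0) (0, j)" using ij(3,4)
  proof (induction j rule: int_ge_induct)
    case (step j)
    have "joined N E (0, j) (0, j + 1)"
      by (rule joined_step)
         (use step s hedge_range(1)[of 0 "j + 1"] in \<open>auto simp: cells_def lattice_adj_def hedge_def\<close>)
    moreover have "joined N E (0, 0) (0, j)" using step by simp
    ultimately show ?case using joined_trans by metis
  qed simp
  show ?thesis using ij(1,2)
  proof (induction i rule: int_ge_induct)
    case base
    show ?case using joined_trans[OF joined_sym[OF joined_bottom] column] by simp
  next
    case (step i)
    show ?case
    proof (cases "vedge E (i + 1) j")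
      case True
      then obtain xs a b ys where W': "W = xs @ a # b # ys" "{(i + 1, j), (i + 1, j + 1)} = {a, b}"
        using edge_split unfolding vedge_def by blast
      then have "a = (i + 1, j) \<and> b = (i + 1, j + 1) \<or> a = (i + 1, j + 1) \<and> b = (i + 1, j)"
        by (auto simp: doubleton_eq_iff)
      then have "left_cell a b = (i + 1, j) \<or> left_cell b a = (i + 1, j)"
        by (auto simp: left_cell_def)
      then show ?thesis using sides_joined[OF W'(1)] by auto
    next
      case False
      have "joined N E (i, j) (i + 1, j)"
        by (rule joined_step) (use step ij False in \<open>auto simp: cells_def lattice_adj_def vedge_def\<close>)
      moreover have "joined N E (s - 1, 0) (i, j) \<or> joined N E (s, 0) (i, j)" using step by simp
      ultimately show ?thesis using joined_trans by metis
    qed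
  qed
qed

lemma colour_origin: "\<not> colour E (0, 0)"
proof -
  have empty: "{y. 1 \<le> y \<and> y \<le> (0::int) \<and> P y} = {}" for P by auto
  show ?thesis by (simp add: colour_def empty)
qed

lemma colour_start: "\<not> colour E (s - 1, 0)" "colour E (s, 0)"
proof -
  show *: "\<not> colour E (s - 1, 0)"
    using joined_imp_linked[OF lattice even_inner joined_bottom] colour_origin by simp
  have "wall (s - 1, 0) (s, 0) \<in> E" using vedge_bottom[of s] by (simp add: wall_def vedge_def)
  then show "colour E (s, 0)"
    using * colour_wall[OF lattice even_inner, of "(s - 1, 0)" "(s, 0)"] s
    by (auto simp: cells_def lattice_adj_def)
qed

lemma polyomino_class:
  assumes a: "a \<in> cells N"
    and all: "\<And>c. c \<in> cells N \<Longrightarrow> colour E c = colour E a \<Longrightarrow> joined N E a c"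
  shows "polyomino {c \<in> cells N. colour E c = colour E a}"
  unfolding polyomino_iff_linked
proof (intro conjI ballI)
  show "{c \<in> cells N. colour E c = colour E a} \<noteq> {}" using a by auto
  fix b c assume "b \<in> {c \<in> cells N. colour E c = colour E a}" "c \<in> {c \<in> cells N. colour E c = colour E a}"
  then show "linked {c \<in> cells N. colour E c = colour E a} b c"
    using joined_imp_linked[OF lattice even_inner all] linked_sym linked_trans by blast
qed

lemma polyomino_right_part: "polyomino right_part"
proof -
  have "joined N E (s, 0) c" if "c \<in> cells N" "colour E c = colour E (s, 0)" for c
    using joined_side[of "fst c" "snd c"] that colour_start
      joined_imp_linked[OF lattice even_inner, of "(s - 1, 0)" c] by auto
  then have "polyomino {c \<in> cells N. colour E c = colour E (s, 0)}"
    by (rule polyomino_class[rotated]) (use s in \<open>auto simp: cells_def\<close>)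
  then show ?thesis using colour_start by (simp add: right_part_def)
qed

lemma polyomino_left_part: "polyomino (cells N - right_part)"
proof -
  have "joined N E (s - 1, 0) c" if "c \<in> cells N" "colour E c = colour E (s - 1, 0)" for c
    using joined_side[of "fst c" "snd c"] that colour_start
      joined_imp_linked[OF lattice even_inner, of "(s, 0)" c] by auto
  then have "polyomino {c \<in> cells N. colour E c = colour E (s - 1, 0)}"
    by (rule polyomino_class[rotated]) (use s in \<open>auto simp: cells_def\<close>)
  moreover have "{c \<in> cells N. colour E c = colour E (s - 1, 0)} = cells N - right_part"
    using colour_start by (auto simp: right_part_def)
  ultimately show ?thesis by simp
qed

lemma colour_right_column:
  assumes "0 \<le> j" "j < N"
  shows "colour E (N - 1, j)"
  using assms
proof (induction j rule: int_ge_induct)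
  case base
  have empty: "{y. 1 \<le> y \<and> y \<le> (0::int) \<and> P y} = {}" for P by auto
  have "{x. 1 \<le> x \<and> x \<le> N - 1 \<and> vedge E x 0} = {s}" using vedge_bottom s by auto
  then show ?case by (simp add: colour_def empty)
next
  case (step j)
  have "\<not> hedge E (N - 1) (j + 1)" using hedge_range(2)[of "N - 1" "j + 1"] by auto
  then show ?case using colour_up[OF lattice even_inner, of "N - 1" j] step by auto
qed

end

section \<open>Pairs of half walks of equal area\<close>

text \<open>The inner points left of the middle column, and the entry point below the last of these columns.\<close>

definition half :: "int \<Rightarrow> point set" where
  "half n = {1..n - 1} \<times> {1..2 * n - 1} \<union> {(n - 1, 0)}"

definition half_walks :: "int \<Rightarrow> point list set" where
  "half_walks n = walks (half n) (n - 1, 0) (n - 1, 2 * n - 1)"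

definition turn :: "int \<Rightarrow> point \<Rightarrow> point" where
  "turn n = (\<lambda>(x, y). (2 * n - x, 2 * n - y))"

text \<open>There is only one walk down the middle column; choosing it avoids writing down the list.\<close>

definition spine :: "int \<Rightarrow> point list" where
  "spine n = (SOME p. p \<in> walks ({n} \<times> {1..2 * n - 1}) (n, 2 * n - 1) (n, 1))"

definition full_walk :: "int \<Rightarrow> point list \<Rightarrow> point list \<Rightarrow> point list" where
  "full_walk n u u' = u @ spine n @ rev (map (turn n) u')"

text \<open>The part of the left half of the board that lies on the right of the walk.\<close>

definition area :: "int \<Rightarrow> point list \<Rightarrow> nat" where
  "area n u = card {c \<in> {0..<n} \<times> {0..<2 * n}. colour (edges u) c}"

lemma turn_turn [simp]: "turn n (turn n v) = v"
  by (cases v) (simp add: turn_def)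

lemma inj_turn: "inj (turn n)"
  by (rule inj_on_inverseI[of _ "turn n"]) simp

lemma turn_adj: "lattice_adj (turn n u) (turn n v) \<longleftrightarrow> lattice_adj u v"
  by (cases u; cases v) (auto simp: turn_def lattice_adj_def)

lemma spine:
  assumes "n \<ge> 2"
  shows "spine n \<in> walks ({n} \<times> {1..2 * n - 1}) (n, 2 * n - 1) (n, 1)"
proof -
  let ?S = "{n} \<times> {1..2 * n - 1}"
  have "linked ?S (n, 1) (n, 2 * n - 1)"
    using linked_along[of 1 "2 * n - 1" "\<lambda>k. (n, k)" ?S] assms by (auto simp: lattice_adj_def)
  then have "walks ?S (n, 2 * n - 1) (n, 1) \<noteq> {}"
    using walks_nonempty[OF linked_sym] assms by fastforce
  then show ?thesis unfolding spine_def by (metis ex_in_conv someI_ex)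
qed

locale two_halves =
  fixes n :: int and u u' :: "point list"
  assumes n: "n \<ge> 2" and u: "u \<in> half_walks n" and u': "u' \<in> half_walks n"
begin

lemma set_u: "(x, y) \<in> set u \<Longrightarrow> 0 < x \<and> x < n"
  and set_u': "(x, y) \<in> set u' \<Longrightarrow> 0 < x \<and> x < n"
proof -
  have "set u \<subseteq> half n" "set u' \<subseteq> half n"
    using u u' by (simp_all add: half_walks_def walks_def)
  moreover have "0 < x \<and> x < n" if "(x, y) \<in> half n"
    using that n by (auto simp: half_def)
  ultimately show "(x, y) \<in> set u \<Longrightarrow> 0 < x \<and> x < n" "(x, y) \<in> set u' \<Longrightarrow> 0 < x \<and> x < n"
    by blast+
qed

lemma set_spine: "(x, y) \<in> set (spine n) \<Longrightarrow> x = n"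
  using spine[OF n] by (auto simp: walks_def)

lemma turned: "rev (map (turn n) u') \<in> walks (turn n ` half n) (n + 1, 1) (n + 1, 2 * n)"
proof -
  have "map (turn n) u' \<in> walks (turn n ` half n) (turn n (n - 1, 0)) (turn n (n - 1, 2 * n - 1))"
    using u' unfolding half_walks_def by (subst map_in_walks_iff) (simp_all add: turn_adj inj_turn)
  then have "map (turn n) u' \<in> walks (turn n ` half n) (n + 1, 2 * n) (n + 1, 1)"
    by (simp add: turn_def)
  then show ?thesis by (rule walks_rev)
qed

lemma turn_half: "turn n ` half n = {n + 1..2 * n - 1} \<times> {1..2 * n - 1} \<union> {(n + 1, 2 * n)}"
proof (intro equalityI subsetI)
  fix v assume "v \<in> {n + 1..2 * n - 1} \<times> {1..2 * n - 1} \<union> {(n + 1, 2 * n)}"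
  then have "turn n v \<in> half n" by (cases v) (auto simp: turn_def half_def)
  then show "v \<in> turn n ` half n" by (rule image_eqI[rotated]) simp
qed (auto simp: turn_def half_def)

lemma full_walk_in:
  "full_walk n u u' \<in> walks (half n \<union> ({n} \<times> {1..2 * n - 1} \<union> turn n ` half n)) (n - 1, 0) (n + 1, 2 * n)"
proof -
  have "spine n @ rev (map (turn n) u') \<in>
      walks ({n} \<times> {1..2 * n - 1} \<union> turn n ` half n) (n, 2 * n - 1) (n + 1, 2 * n)"
    by (rule walks_append[OF spine[OF n] turned]) (auto simp: turn_half lattice_adj_def)
  moreover have "half n \<inter> ({n} \<times> {1..2 * n - 1} \<union> turn n ` half n) = {}"
    unfolding turn_half by (auto simp: half_def)
  moreover have "lattice_adj (n - 1, 2 * n - 1) (n, 2 * n - 1)" by (simp add: lattice_adj_def)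
  ultimately show ?thesis
    unfolding full_walk_def by (rule walks_append[OF u[unfolded half_walks_def]])
qed

sublocale board_crossing "2 * n" "n - 1" "n + 1" "full_walk n u u'"
proof
  have "half n \<union> ({n} \<times> {1..2 * n - 1} \<union> turn n ` half n) \<subseteq>
      {1..2 * n - 1} \<times> {1..2 * n - 1} \<union> {(n - 1, 0), (n + 1, 2 * n)}" (is "_ \<subseteq> ?T")
  proof (intro Un_least)
    have col: "I \<times> {1..2 * n - 1} \<subseteq> ?T" if "I \<subseteq> {1..2 * n - 1}" for I
      using that by (intro le_supI1 Sigma_mono) auto
    show "half n \<subseteq> ?T"
      unfolding half_def by (intro Un_least col) (use n in simp_all)
    show "{n} \<times> {1..2 * n - 1} \<subseteq> ?T" by (intro col) (use n in auto)
    show "turn n ` half n \<subseteq> ?T"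
      unfolding turn_half by (intro Un_least col) (use n in simp_all)
  qed
  then show "full_walk n u u' \<in>
      walks ({1..2 * n - 1} \<times> {1..2 * n - 1} \<union> {(n - 1, 0), (n + 1, 2 * n)}) (n - 1, 0) (n + 1, 2 * n)"
    by (rule subsetD[OF walks_mono full_walk_in])
qed (use n in auto)

lemma edges_full_walk:
  "edges (full_walk n u u') = edges u \<union> edges (spine n) \<union> (\<lambda>e. turn n ` e) ` edges u' \<union>
     {{(n - 1, 2 * n - 1), (n, 2 * n - 1)}, {(n, 1), (n + 1, 1)}}"
proof -
  have "u \<noteq> []" "last u = (n - 1, 2 * n - 1)"
    using u by (auto simp: half_walks_def walks_def self_avoiding_walk_def)
  moreover have "spine n \<noteq> []" "hd (spine n) = (n, 2 * n - 1)" "last (spine n) = (n, 1)"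
    using spine[OF n] by (auto simp: walks_def self_avoiding_walk_def)
  moreover have "rev (map (turn n) u') \<noteq> []" "hd (rev (map (turn n) u')) = (n + 1, 1)"
    using turned by (auto simp: walks_def self_avoiding_walk_def)
  ultimately show ?thesis
    unfolding full_walk_def by (simp only: edges_append append_is_Nil_conv hd_append if_False
        edges_rev edges_map de_Morgan_conj simp_thms) blast
qed

lemma vedge_left: "x < n \<Longrightarrow> vedge E x y \<longleftrightarrow> vedge (edges u) x y"
proof -
  assume "x < n"
  let ?e = "{(x, y), (x, y + 1)}"
  have "?e \<notin> edges (spine n)"
    using edges_subset[of ?e "spine n"] set_spine[of x y] \<open>x < n\<close> by auto
  moreover have "?e \<notin> (\<lambda>e. turn n ` e) ` edges u'"
  proof
    assume "?e \<in> (\<lambda>e. turn n ` e) ` edges u'"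
    then have "?e \<in> edges (map (turn n) u')" by (simp add: edges_map)
    then have "(x, y) \<in> turn n ` set u'" using edges_subset by fastforce
    then obtain a b where "(a, b) \<in> set u'" "(x, y) = turn n (a, b)" by auto
    then show False using set_u'[of a b] \<open>x < n\<close> by (simp add: turn_def)
  qed
  moreover have "?e \<noteq> {(n - 1, 2 * n - 1), (n, 2 * n - 1)}" "?e \<noteq> {(n, 1), (n + 1, 1)}"
    by (auto simp: doubleton_eq_iff)
  ultimately show ?thesis unfolding vedge_def edges_full_walk by blast
qed

lemma vedge_right: "x > n \<Longrightarrow> vedge E x y \<longleftrightarrow> vedge (edges u') (2 * n - x) (2 * n - 1 - y)"
proof -
  assume "x > n"
  let ?e = "{(x, y), (x, y + 1)}"
  have "?e \<notin> edges (spine n)"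
    using edges_subset[of ?e "spine n"] set_spine[of x y] \<open>x > n\<close> by auto
  moreover have "?e \<notin> edges u"
    using edges_subset[of ?e u] set_u[of x y] \<open>x > n\<close> by auto
  moreover have "?e \<in> (\<lambda>e. turn n ` e) ` edges u' \<longleftrightarrow> turn n ` ?e \<in> edges u'"
  proof
    assume "?e \<in> (\<lambda>e. turn n ` e) ` edges u'"
    then obtain e where "e \<in> edges u'" "?e = turn n ` e" by blast
    moreover have "turn n ` turn n ` e = e" for e by (simp add: image_image)
    ultimately show "turn n ` ?e \<in> edges u'" by metis
  next
    assume "turn n ` ?e \<in> edges u'"
    then show "?e \<in> (\<lambda>e. turn n ` e) ` edges u'"
      by (rule image_eqI[rotated]) (simp only: image_image turn_turn image_ident)
  qed
  moreover have "?e \<noteq> {(n - 1, 2 * n - 1), (n, 2 * n - 1)}" "?e \<noteq> {(n, 1), (n + 1, 1)}"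
    by (auto simp: doubleton_eq_iff)
  ultimately have "?e \<in> E \<longleftrightarrow> turn n ` ?e \<in> edges u'" unfolding edges_full_walk by blast
  moreover have "turn n ` ?e = {(2 * n - x, 2 * n - 1 - y), (2 * n - x, 2 * n - 1 - y + 1)}"
    by (auto simp: turn_def)
  ultimately show ?thesis by (simp only: vedge_def)
qed

lemma colour_left: "i < n \<Longrightarrow> colour E (i, j) = colour (edges u) (i, j)"
proof -
  assume "i < n"
  have "\<not> hedge E 0 y" "\<not> hedge (edges u) 0 y" for y
    using hedge_range(1)[of 0 y] edges_subset[of "{(0, y), (1, y)}" u] set_u[of 0 y]
    by (auto simp: hedge_def)
  moreover have "{x. 1 \<le> x \<and> x \<le> i \<and> vedge E x j} = {x. 1 \<le> x \<and> x \<le> i \<and> vedge (edges u) x j}"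
    using vedge_left[of _ j] \<open>i < n\<close> by auto
  ultimately show ?thesis by (simp add: colour_def)
qed

lemma colour_first_column: "\<not> colour (edges u') (0, j)"
proof -
  have empty: "{x. 1 \<le> x \<and> x \<le> (0::int) \<and> P x} = {}" for P by auto
  have "\<not> hedge (edges u') 0 y" for y
    using edges_subset[of "{(0, y), (1, y)}" u'] set_u'[of 0 y] by (auto simp: hedge_def)
  then show ?thesis by (simp add: colour_def empty)
qed

text \<open>Counted from the right end of a row the parities are complemented, as every row is crossed an
  odd number of times. In these coordinates the right half of the board looks like the left half
  of the second half walk.\<close>

lemma colour_turned:
  assumes "0 \<le> m" "m < n" "0 \<le> j" "j < 2 * n"
  shows "colour E (2 * n - 1 - m, j) \<longleftrightarrow> \<not> colour (edges u') (m, 2 * n - 1 - j)"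
  using assms(1,2)
proof (induction m rule: int_ge_induct)
  case base
  then show ?case using colour_right_column[OF assms(3,4)] colour_first_column by simp
next
  case (step m)
  have "colour E (2 * n - 2 - m + 1, j) \<noteq> colour E (2 * n - 2 - m, j) \<longleftrightarrow> vedge E (2 * n - 2 - m + 1) j"
    by (rule colour_right) (use step in simp)
  moreover have "vedge E (2 * n - 2 - m + 1) j \<longleftrightarrow> vedge (edges u') (m + 1) (2 * n - 1 - j)"
    using vedge_right[of "2 * n - 2 - m + 1" j] step by (simp add: algebra_simps)
  moreover have "colour (edges u') (m + 1, 2 * n - 1 - j) \<noteq> colour (edges u') (m, 2 * n - 1 - j) \<longleftrightarrow>
      vedge (edges u') (m + 1) (2 * n - 1 - j)"
    by (rule colour_right) (use step in simp)
  moreover have "2 * n - 2 - m + 1 = 2 * n - 1 - m" by simp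
  moreover have "colour E (2 * n - 1 - m, j) \<longleftrightarrow> \<not> colour (edges u') (m, 2 * n - 1 - j)"
    using step by simp
  ultimately have "colour E (2 * n - 2 - m, j) \<longleftrightarrow> \<not> colour (edges u') (m + 1, 2 * n - 1 - j)"
    by metis
  moreover have "2 * n - 1 - (m + 1) = 2 * n - 2 - m" by simp
  ultimately show ?case by (simp only:)
qed

text \<open>In the right half the half turn exchanges the two sides of the walk, so the area of the second
  half walk enters with the opposite sign.\<close>

lemma card_right_part: "card right_part + area n u' = area n u + 2 * (nat n)\<^sup>2"
proof -
  let ?H = "{0..<n} \<times> {0..<2 * n}"
  let ?g = "\<lambda>(i, j). (2 * n - 1 - i, 2 * n - 1 - j)"
  let ?A = "{c \<in> ?H. colour (edges u) c}" and ?B = "{c \<in> ?H. \<not> colour (edges u') c}"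
  have "right_part = ?A \<union> ?g ` ?B"
  proof (intro set_eqI)
    fix c :: point
    obtain i j where c: "c = (i, j)" by (cases c)
    have g: "c \<in> ?g ` ?B \<longleftrightarrow> (2 * n - 1 - i, 2 * n - 1 - j) \<in> ?B"
    proof
      assume "(2 * n - 1 - i, 2 * n - 1 - j) \<in> ?B"
      then show "c \<in> ?g ` ?B" by (rule image_eqI[rotated]) (simp add: c)
    qed (auto simp: c)
    show "c \<in> right_part \<longleftrightarrow> c \<in> ?A \<union> ?g ` ?B"
    proof (cases "i < n")
      case True
      then have "c \<notin> ?g ` ?B" unfolding g by simp
      moreover have "i < 2 * n" using True n by simp
      then have "c \<in> right_part \<longleftrightarrow> c \<in> ?A"
        using colour_left[OF True, of j] True by (simp add: c right_part_def cells_def)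
      ultimately show ?thesis by blast
    next
      case False
      then have notA: "c \<notin> ?A" by (simp add: c)
      have "c \<in> right_part \<longleftrightarrow> (2 * n - 1 - i, 2 * n - 1 - j) \<in> ?B"
      proof (cases "i < 2 * n \<and> 0 \<le> j \<and> j < 2 * n")
        case True
        then have "colour E (i, j) \<longleftrightarrow> \<not> colour (edges u') (2 * n - 1 - i, 2 * n - 1 - j)"
          using colour_turned[of "2 * n - 1 - i" j] False by simp
        then show ?thesis using True False n by (simp add: c right_part_def cells_def)
      next
        case False
        then show ?thesis by (auto simp: c right_part_def cells_def)
      qed
      then show ?thesis using notA g by blast
    qed
  qed
  moreover have "?A \<inter> ?g ` ?B = {}" by auto
  moreover have "inj_on ?g ?B" by (auto simp: inj_on_def)
  ultimately have "card right_part = card ?A + card ?B"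
    by (simp add: card_Un_disjoint card_image)
  moreover have "card ?B + area n u' = card ?H"
  proof -
    have "?H = ?B \<union> {c \<in> ?H. colour (edges u') c}" by blast
    moreover have "card (?B \<union> {c \<in> ?H. colour (edges u') c}) = card ?B + area n u'"
      unfolding area_def by (rule card_Un_disjoint) auto
    ultimately show ?thesis by simp
  qed
  moreover have "card ?H = 2 * (nat n)\<^sup>2"
    using n by (simp add: power2_eq_square nat_mult_distrib)
  ultimately show ?thesis by (simp add: area_def)
qed

text \<open>No half walk visits the column \<open>x = 0\<close>, so the first column of cells never counts. For
  \<open>n = 3\<close> this saving is decisive.\<close>

lemma area_le: "area n u' \<le> nat ((n - 1) * (2 * n))"
proof -
  have "{c \<in> {0..<n} \<times> {0..<2 * n}. colour (edges u') c} \<subseteq> {1..<n} \<times> {0..<2 * n}"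
  proof
    fix c assume c: "c \<in> {c \<in> {0..<n} \<times> {0..<2 * n}. colour (edges u') c}"
    obtain i j where ij: "c = (i, j)" by (cases c)
    then have "i \<noteq> 0" using colour_first_column[of j] c by auto
    then show "c \<in> {1..<n} \<times> {0..<2 * n}" using c ij by auto
  qed
  then have "area n u' \<le> card ({1..<n} \<times> {0..<2 * n})"
    unfolding area_def by (rule card_mono[rotated]) simp
  also have "\<dots> = nat ((n - 1) * (2 * n))" using n by (simp add: nat_mult_distrib)
  finally show ?thesis .
qed

lemma halves_of_full_walk:
  "filter (\<lambda>v. fst v < n) (full_walk n u u') = u"
  "filter (\<lambda>v. fst v > n) (full_walk n u u') = rev (map (turn n) u')"
proof -
  have u: "fst v < n" if "v \<in> set u" for v using set_u[of "fst v" "snd v"] that by simp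
  have sp: "fst v = n" if "v \<in> set (spine n)" for v using set_spine[of "fst v" "snd v"] that by simp
  have r: "fst v > n" if v: "v \<in> set (rev (map (turn n) u'))" for v
  proof -
    obtain w where "w \<in> set u'" "v = turn n w" using v by auto
    then show ?thesis using set_u'[of "fst w" "snd w"] by (simp add: turn_def case_prod_unfold)
  qed
  have f: "filter P (full_walk n u u') = filter P u @ filter P (spine n) @ filter P (rev (map (turn n) u'))"
    for P unfolding full_walk_def by (simp only: filter_append)
  have "filter (\<lambda>v. fst v < n) u = u" using u by (intro filter_True) blast
  moreover have "filter (\<lambda>v. fst v < n) (spine n) = []" using sp by (intro filter_False) fastforce
  moreover have "filter (\<lambda>v. fst v < n) (rev (map (turn n) u')) = []" using r by (intro filter_False) fastforce
  ultimately show "filter (\<lambda>v. fst v < n) (full_walk n u u') = u" unfolding f by simp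
  have "filter (\<lambda>v. fst v > n) u = []" using u by (intro filter_False) fastforce
  moreover have "filter (\<lambda>v. fst v > n) (spine n) = []" using sp by (intro filter_False) fastforce
  moreover have "filter (\<lambda>v. fst v > n) (rev (map (turn n) u')) = rev (map (turn n) u')"
    using r by (intro filter_True) blast
  ultimately show "filter (\<lambda>v. fst v > n) (full_walk n u u') = rev (map (turn n) u')"
    unfolding f by simp
qed

end

lemma finite_half_walks: "finite (half_walks n)"
  unfolding half_walks_def by (rule finite_walks) (simp add: half_def)

lemma equal_area_pairs_le:
  assumes L: "L \<ge> 2"
  shows "card {(u, u'). u \<in> half_walks (int L) \<and> u' \<in> half_walks (int L) \<and> area (int L) u = area (int L) u'}
    \<le> gerrymander L"
proof -
  let ?n = "int L" and ?N = "2 * int L"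
  let ?P = "{(u, u'). u \<in> half_walks ?n \<and> u' \<in> half_walks ?n \<and> area ?n u = area ?n u'}"
  let ?up = "\<lambda>W. {c \<in> cells ?N. colour (edges W) c}"
  let ?f = "\<lambda>(u, u'). cells ?N - ?up (full_walk ?n u u')"
  let ?D = "{A. A \<subseteq> cells ?N \<and> (0, 0) \<in> A \<and> polyomino A
    \<and> polyomino (cells ?N - A) \<and> card A = 2 * L\<^sup>2}"
  have finC: "finite (cells ?N)" and cardC: "card (cells ?N) = 4 * L\<^sup>2" and orig: "(0, 0) \<in> cells ?N"
    using L by (auto simp: cells_def power2_eq_square nat_mult_distrib)
  have halves: "two_halves ?n u u'" if "u \<in> half_walks ?n" "u' \<in> half_walks ?n" for u u'
    using that L by unfold_locales auto
  have "?f ` ?P \<subseteq> ?D"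
  proof (rule image_subsetI, elim CollectE case_prodE)
    fix z u u' assume z: "z = (u, u')"
      and eq: "u \<in> half_walks ?n \<and> u' \<in> half_walks ?n \<and> area ?n u = area ?n u'"
    interpret two_halves ?n u u' using halves eq by blast
    have "card right_part = 2 * L\<^sup>2" using card_right_part conjunct2[OF conjunct2[OF eq]] by simp
    moreover have "right_part \<subseteq> cells ?N" by (auto simp: right_part_def)
    ultimately have "card (cells ?N - right_part) = 2 * L\<^sup>2"
      using cardC finC by (simp add: card_Diff_subset finite_subset)
    moreover have "cells ?N - (cells ?N - right_part) = right_part" using \<open>right_part \<subseteq> cells ?N\<close> by blast
    moreover have "(0, 0) \<notin> right_part" using colour_origin by (simp add: right_part_def)
    ultimately have "cells ?N - right_part \<in> ?D"
      using polyomino_right_part polyomino_left_part orig by simp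
    then show "?f z \<in> ?D" unfolding z prod.case right_part_def .
  qed
  moreover have "inj_on ?f ?P"
  proof (rule inj_onI, elim CollectE case_prodE)
    fix z z' u u' v v' assume e: "?f z = ?f z'" and z: "z = (u, u')" "z' = (v, v')"
      and u: "u \<in> half_walks ?n \<and> u' \<in> half_walks ?n \<and> area ?n u = area ?n u'"
      and v: "v \<in> half_walks ?n \<and> v' \<in> half_walks ?n \<and> area ?n v = area ?n v'"
    interpret U: two_halves ?n u u' using halves u by blast
    interpret V: two_halves ?n v v' using halves v by blast
    have "cells ?N - U.right_part = cells ?N - V.right_part"
      using e unfolding z prod.case U.right_part_def V.right_part_def .
    moreover have "U.right_part \<subseteq> cells ?N" "V.right_part \<subseteq> cells ?N"
      by (auto simp: U.right_part_def V.right_part_def)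
    ultimately have "U.right_part = V.right_part" by blast
    then have "edges (full_walk ?n u u') = edges (full_walk ?n v v')"
      using U.interface_right_part V.interface_right_part by simp
    then have W: "full_walk ?n u u' = full_walk ?n v v'"
      using U.dist V.dist U.ne V.ne U.hdW V.hdW by (intro walk_eqI) auto
    then have "u = v" using U.halves_of_full_walk(1) V.halves_of_full_walk(1) by simp
    moreover have "rev (map (turn ?n) u') = rev (map (turn ?n) v')"
      using W U.halves_of_full_walk(2) V.halves_of_full_walk(2) by simp
    then have "u' = v'" using inj_turn by (simp add: inj_map_eq_map)
    ultimately show "z = z'" using z by simp
  qed
  moreover have "finite ?D" by (rule finite_subset[of _ "Pow (cells ?N)"]) (use finC in auto)
  ultimately have "card ?P \<le> card ?D" by (intro card_inj_on_le)
  also have "\<dots> = gerrymander L" using gerrymander_eq[of L] L by simp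
  finally show ?thesis .
qed

text \<open>Cauchy-Schwarz for the sizes of the fibres of \<open>f\<close>.\<close>

lemma card_square_le_equal_pairs:
  fixes f :: "'a \<Rightarrow> nat"
  assumes "finite H" "\<And>u. u \<in> H \<Longrightarrow> f u \<le> K"
  shows "(card H)\<^sup>2 \<le> (K + 1) * card {(u, v). u \<in> H \<and> v \<in> H \<and> f u = f v}"
proof -
  define F where "F = (\<lambda>k. {u \<in> H. f u = k})"
  have fin: "finite (F k)" for k using assms(1) by (simp add: F_def)
  have "H = (\<Union>k\<in>{..K}. F k)" using assms(2) by (auto simp: F_def)
  moreover have "card (\<Union>k\<in>{..K}. F k) = (\<Sum>k\<le>K. card (F k))"
    using fin by (intro card_UN_disjoint) (auto simp: F_def)
  ultimately have H: "card H = (\<Sum>k\<le>K. card (F k))" by simp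
  have "{(u, v). u \<in> H \<and> v \<in> H \<and> f u = f v} = (\<Union>k\<in>{..K}. F k \<times> F k)"
    using assms(2) by (auto simp: F_def)
  moreover have "card (\<Union>k\<in>{..K}. F k \<times> F k) = (\<Sum>k\<le>K. card (F k \<times> F k))"
    using fin by (intro card_UN_disjoint) (auto simp: F_def)
  ultimately have P: "card {(u, v). u \<in> H \<and> v \<in> H \<and> f u = f v} = (\<Sum>k\<le>K. (card (F k))\<^sup>2)"
    by (simp add: card_cartesian_product power2_eq_square)
  have "(\<Sum>k\<le>K. real (card (F k)))\<^sup>2 \<le> (\<Sum>k\<le>K. (real (card (F k)))\<^sup>2) * card {..K}"
    by (rule sum_squared_le_sum_of_squares)
  then have "real ((card H)\<^sup>2) \<le> real ((K + 1) * (\<Sum>k\<le>K. (card (F k))\<^sup>2))"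
    unfolding H by (simp add: algebra_simps)
  then show ?thesis unfolding P by (simp only: of_nat_le_iff)
qed

text \<open>The lower square is crossed from its right bottom to its left top corner and the upper one
  from its left bottom to its right top corner; the row between them holds a single linking point.\<close>

lemma card_half_walks_ge:
  assumes "L \<ge> 1"
  shows "(card (wcas L))\<^sup>2 \<le> card (half_walks (int L + 2))"
proof -
  let ?L = "int L"
  let ?B = "rect ?L ?L"
  let ?f = "\<lambda>(x, y). (?L + 1 - x, 1 + y)" and ?g = "\<lambda>(x, y). (1 + x, ?L + 3 + y)"
  let ?s = "(?L + 1, 0)" and ?c = "(1, ?L + 2)"
  let ?C = "card (wcas L)"
  have f: "?C = card (walks (?f ` ?B) (?L + 1, 1) (1, ?L + 1))"
    unfolding wcas_eq_walks by (rule card_walks_image[symmetric]) (auto simp: lattice_adj_def inj_def)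
  have g: "?C = card (walks (?g ` ?B) (1, ?L + 3) (?L + 1, 2 * ?L + 3))"
    unfolding wcas_eq_walks by (rule card_walks_image[symmetric]) (auto simp: lattice_adj_def inj_def)
  have pt: "1 \<le> card (walks {v} v v)" for v by (rule card_walks_pos) (auto simp: linked_refl)
  have "?C \<le> card (walks {?s} ?s ?s) * ?C" using pt[of ?s] by simp
  also have "\<dots> \<le> card (walks ({?s} \<union> ?f ` ?B) ?s (1, ?L + 1))"
    unfolding f by (rule card_walks_append) (auto simp: lattice_adj_def)
  also have "\<dots> \<le> card (walks ({?s} \<union> ?f ` ?B) ?s (1, ?L + 1)) * card (walks {?c} ?c ?c)"
    using pt[of ?c] by simp
  also have "\<dots> \<le> card (walks ({?s} \<union> ?f ` ?B \<union> {?c}) ?s ?c)"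
    by (rule card_walks_append) (auto simp: lattice_adj_def)
  finally have "?C * ?C \<le> card (walks ({?s} \<union> ?f ` ?B \<union> {?c}) ?s ?c) * ?C"
    by (rule mult_right_mono) simp
  also have "\<dots> \<le> card (walks ({?s} \<union> ?f ` ?B \<union> {?c} \<union> ?g ` ?B) ?s (?L + 1, 2 * ?L + 3))"
    unfolding g by (rule card_walks_append) (auto simp: lattice_adj_def)
  also have "\<dots> \<le> card (walks (half (?L + 2)) ?s (?L + 1, 2 * ?L + 3))"
    by (rule card_walks_mono) (use assms in \<open>auto simp: half_def\<close>)
  also have "\<dots> = card (half_walks (?L + 2))"
    by (simp add: half_walks_def add.commute)
  finally show ?thesis by (simp add: power2_eq_square)
qed

definition rung :: "int \<Rightarrow> int \<Rightarrow> int \<Rightarrow> point list" where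
  "rung y a b = (if a = b then [(a, y)] else [(a, y), (b, y)])"

text \<open>For \<open>n = 3\<close> the left half is a ladder of width two, and a half walk is free to choose the side on
  which it climbs between any two consecutive rungs.\<close>

definition ladder_walks :: "point list list" where
  "ladder_walks = [(2, 0) # rung 1 2 a @ rung 2 a b @ rung 3 b c @ rung 4 c d @ rung 5 d 2.
     a \<leftarrow> [1, 2], b \<leftarrow> [1, 2], c \<leftarrow> [1, 2], d \<leftarrow> [1, 2]]"

lemma ladder_walks_in: "set ladder_walks \<subseteq> half_walks 3"
  by (auto simp: ladder_walks_def rung_def half_walks_def walks_def self_avoiding_walk_def half_def
      lattice_adj_def)

lemma distinct_ladder_walks: "distinct ladder_walks" "length ladder_walks = 16"
  by (simp_all add: ladder_walks_def rung_def)

lemma card_half_walks_3: "16 \<le> card (half_walks 3)"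
  using card_mono[OF finite_half_walks ladder_walks_in] distinct_ladder_walks
  by (simp add: distinct_card)

lemma card_wcas_1: "card (wcas 1) \<le> 2"
proof -
  have "wcas 1 \<subseteq> {[(0, 0), (1, 0), (1, 1)], [(0, 0), (0, 1), (1, 1)]}"
  proof
    fix p assume "p \<in> wcas 1"
    then have p: "distinct p" "successively lattice_adj p" "p \<noteq> []" "hd p = (0, 0)" "last p = (1, 1)"
      "set p \<subseteq> {0..1} \<times> {0..1}"
      by (auto simp: wcas_def self_avoiding_walk_def)
    obtain a q where pa: "p = (0, 0) # a # q"
      using p(3-5) by (cases p; cases "tl p") auto
    then have a: "a = (1, 0) \<or> a = (0, 1)" using p(2,6) by (auto simp: lattice_adj_Pair)
    then obtain b r where pb: "p = (0, 0) # a # b # r" using p(5) pa by (cases q) auto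
    have b: "b = (1, 1)" using a p(1,2,6) unfolding pb by (auto simp: lattice_adj_Pair)
    have "r = []"
    proof (rule ccontr)
      assume "r \<noteq> []"
      then have "(1, 1) \<in> set r" using p(5) pb last_in_set[of r] by simp
      then show False using p(1) pb b by simp
    qed
    then show "p \<in> {[(0, 0), (1, 0), (1, 1)], [(0, 0), (0, 1), (1, 1)]}" using pb a b by auto
  qed
  then have "card (wcas 1) \<le> card {[(0, 0), (1, 0), (1, 1)], [(0, 0), (0, 1), (1 :: int, 1 :: int)]}"
    by (rule card_mono[rotated]) simp
  then show ?thesis by simp
qed

lemma half_walks_square_le:
  assumes "L \<ge> 1"
  shows "(card (half_walks (int L + 2)))\<^sup>2 \<le> ((L + 1) * (2 * L + 4) + 1) * gerrymander (L + 2)"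
proof -
  let ?n = "int (L + 2)"
  have n: "?n \<ge> 2" by simp
  have "area ?n u \<le> (L + 1) * (2 * L + 4)" if "u \<in> half_walks ?n" for u
  proof -
    interpret two_halves ?n u u using that n by unfold_locales
    have "nat ((?n - 1) * (2 * ?n)) = (L + 1) * (2 * L + 4)"
      by (simp add: nat_mult_distrib nat_add_distrib)
    then show ?thesis using area_le by simp
  qed
  then have "(card (half_walks ?n))\<^sup>2 \<le> ((L + 1) * (2 * L + 4) + 1) *
      card {(u, v). u \<in> half_walks ?n \<and> v \<in> half_walks ?n \<and> area ?n u = area ?n v}"
    by (rule card_square_le_equal_pairs[OF finite_half_walks])
  also have "\<dots> \<le> ((L + 1) * (2 * L + 4) + 1) * gerrymander (L + 2)"
    by (intro mult_left_mono equal_area_pairs_le) auto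
  finally show ?thesis by (simp add: add.commute)
qed

text \<open>For \<open>L = 1\<close> the four stacked pairs of walks would give too little: the 16 ladder walks with 13
  possible areas give at least \<open>16\<^sup>2 / 13 > 16\<close>, which is just enough.\<close>

lemma gerrymander_ge:
  assumes "L \<ge> 1"
  shows "(card (wcas L)) ^ 4 \<le> L ^ 8 * gerrymander (L + 2)"
proof (cases "L = 1")
  case True
  have "(16::nat)\<^sup>2 \<le> (card (half_walks 3))\<^sup>2" using card_half_walks_3 by (rule power_mono) simp
  also have "\<dots> \<le> 13 * gerrymander 3" using half_walks_square_le[of 1] by (simp add: numeral_3_eq_3)
  finally have "16 \<le> gerrymander 3" by simp
  moreover have "card (wcas 1) ^ 4 \<le> 2 ^ 4" using card_wcas_1 by (rule power_mono) simp
  ultimately show ?thesis using True by (simp add: numeral_3_eq_3)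
next
  case False
  then have L: "L \<ge> 2" using assms by simp
  have "(L + 1) * (2 * L + 4) + 1 \<le> L ^ 8"
  proof -
    have "(L + 1) * (2 * L + 4) + 1 \<le> (2 * L) * (4 * L) + L * L"
      using L by (intro add_mono mult_mono) auto
    also have "\<dots> \<le> 64 * L\<^sup>2" by (simp add: power2_eq_square)
    also have "\<dots> = 2 ^ 6 * L\<^sup>2" by simp
    also have "\<dots> \<le> L ^ 6 * L\<^sup>2" by (intro mult_right_mono power_mono L) auto
    also have "\<dots> = L ^ 8" by (simp add: power_add[symmetric])
    finally show ?thesis .
  qed
  have "card (wcas L) ^ 4 = ((card (wcas L))\<^sup>2)\<^sup>2" by (simp add: power_mult[symmetric])
  also have "\<dots> \<le> (card (half_walks (int L + 2)))\<^sup>2"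
    by (intro power_mono card_half_walks_ge assms) auto
  also have "\<dots> \<le> ((L + 1) * (2 * L + 4) + 1) * gerrymander (L + 2)"
    by (rule half_walks_square_le[OF assms])
  also have "\<dots> \<le> L ^ 8 * gerrymander (L + 2)"
    by (intro mult_right_mono \<open>_ \<le> L ^ 8\<close>) auto
  finally show ?thesis .
qed

section \<open>The growth constants agree\<close>

text \<open>Replaces the square of the argument of \<open>b\<close> by an asymptotically proportional denominator.\<close>

lemma tendsto_quadratic_shift:
  assumes lim: "(\<lambda>K. b K / (real K)\<^sup>2) \<longlonglongrightarrow> s"
    and k: "filterlim k at_top sequentially"
    and r: "(\<lambda>L. (real (k L))\<^sup>2 / d L) \<longlonglongrightarrow> r"
  shows "(\<lambda>L. b (k L) / d L) \<longlonglongrightarrow> s * r"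
proof -
  have "(\<lambda>L. b (k L) / (real (k L))\<^sup>2 * ((real (k L))\<^sup>2 / d L)) \<longlonglongrightarrow> s * r"
    by (intro tendsto_mult r filterlim_compose[OF lim k])
  moreover have "\<forall>\<^sub>F L in sequentially. k L \<ge> 1"
    using k by (auto simp: filterlim_at_top)
  then have "\<forall>\<^sub>F L in sequentially.
      b (k L) / (real (k L))\<^sup>2 * ((real (k L))\<^sup>2 / d L) = b (k L) / d L"
    by eventually_elim auto
  ultimately show ?thesis by (rule Lim_transform_eventually)
qed

theorem theorem4:
  "(\<forall>L\<ge>1. real (gerrymander (L + 2)) \<ge> (real (card (wcas L)) / (real L)\<^sup>2) ^ 4) \<and>
   (\<exists>growth::real.
      (\<lambda>L. real (card (wcas L)) powr (1 / (real L)\<^sup>2)) \<longlonglongrightarrow> growth \<and>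
      (\<lambda>L. real (gerrymander L) powr (1 / (4 * (real L)\<^sup>2))) \<longlonglongrightarrow> growth)"
proof -
  have C: "real (card (wcas L)) > 0" for L using card_wcas_pos[of L] by linarith
  have lower: "(real (card (wcas L)) / (real L)\<^sup>2) ^ 4 \<le> real (gerrymander (L + 2))"
    if "L \<ge> 1" for L
  proof -
    have "real (card (wcas L) ^ 4) \<le> real (L ^ 8 * gerrymander (L + 2))"
      using gerrymander_ge[OF that] by (simp only: of_nat_le_iff)
    then show ?thesis using that
      by (simp add: power_divide divide_le_eq power_mult[symmetric] mult.commute)
  qed
  obtain s where s: "(\<lambda>K. log_wcas K / (real K)\<^sup>2) \<longlonglongrightarrow> s" using log_wcas_limit by blast
  have "(\<lambda>L. log_wcas (L + 1) / (real L)\<^sup>2) \<longlonglongrightarrow> s * 1"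
  proof (rule tendsto_quadratic_shift[OF s])
    show "filterlim (\<lambda>L. L + 1) at_top sequentially" by (rule filterlim_add_const_nat_at_top)
    show "(\<lambda>L. (real (L + 1))\<^sup>2 / (real L)\<^sup>2) \<longlonglongrightarrow> 1" by simp real_asymp
  qed
  then have "(\<lambda>L. exp (log_wcas (L + 1) / (real L)\<^sup>2)) \<longlonglongrightarrow> exp s"
    by (intro tendsto_exp) simp
  moreover have "exp (log_wcas (L + 1) / (real L)\<^sup>2) = real (card (wcas L)) powr (1 / (real L)\<^sup>2)" for L
    using C[of L] by (simp add: powr_def log_wcas_def)
  ultimately have wcas_lim: "(\<lambda>L. real (card (wcas L)) powr (1 / (real L)\<^sup>2)) \<longlonglongrightarrow> exp s"
    by simp
  (* Bounds for the normalised logarithm of gerrymander (L + 2). *)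
  define low where "low = (\<lambda>L. (4 * log_wcas (L + 1) - 8 * ln (real L)) / (4 * (real (L + 2))\<^sup>2))"
  define up where "up = (\<lambda>L. (ln 2 + 4 * ln (2 * real L + 5) + log_wcas (2 * L + 9)) / (4 * (real (L + 2))\<^sup>2))"
  have "(\<lambda>L. log_wcas (L + 1) / (real (L + 2))\<^sup>2 - 2 * ln (real L) / (real (L + 2))\<^sup>2) \<longlonglongrightarrow> s * 1 - 0"
  proof (rule tendsto_diff)
    show "(\<lambda>L. log_wcas (L + 1) / (real (L + 2))\<^sup>2) \<longlonglongrightarrow> s * 1"
    proof (rule tendsto_quadratic_shift[OF s])
      show "filterlim (\<lambda>L. L + 1) at_top sequentially" by (rule filterlim_add_const_nat_at_top)
      show "(\<lambda>L. (real (L + 1))\<^sup>2 / (real (L + 2))\<^sup>2) \<longlonglongrightarrow> 1" by simp real_asymp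
    qed
    show "(\<lambda>L. 2 * ln (real L) / (real (L + 2))\<^sup>2) \<longlonglongrightarrow> 0" by simp real_asymp
  qed
  then have low: "low \<longlonglongrightarrow> s" unfolding low_def by (simp add: diff_divide_distrib)
  have "(\<lambda>L. (ln 2 + 4 * ln (2 * real L + 5)) / (4 * (real (L + 2))\<^sup>2) +
      log_wcas (2 * L + 9) / (4 * (real (L + 2))\<^sup>2)) \<longlonglongrightarrow> 0 + s * 1"
  proof (rule tendsto_add)
    show "(\<lambda>L. log_wcas (2 * L + 9) / (4 * (real (L + 2))\<^sup>2)) \<longlonglongrightarrow> s * 1"
    proof (rule tendsto_quadratic_shift[OF s])
      show "filterlim (\<lambda>L. 2 * L + 9) at_top sequentially" by real_asymp
      show "(\<lambda>L. (real (2 * L + 9))\<^sup>2 / (4 * (real (L + 2))\<^sup>2)) \<longlonglongrightarrow> 1" by simp real_asymp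
    qed
    show "(\<lambda>L. (ln 2 + 4 * ln (2 * real L + 5)) / (4 * (real (L + 2))\<^sup>2)) \<longlonglongrightarrow> 0" by simp real_asymp
  qed
  then have up: "up \<longlonglongrightarrow> s" unfolding up_def by (simp add: add_divide_distrib)
  have pos: "real (gerrymander (L + 2)) > 0" if "L \<ge> 1" for L
  proof -
    have "(real (card (wcas L)) / (real L)\<^sup>2) ^ 4 > 0" using C[of L] that by simp
    then show ?thesis using lower[OF that] by linarith
  qed
  have "(\<lambda>L. ln (real (gerrymander (L + 2))) / (4 * (real (L + 2))\<^sup>2)) \<longlonglongrightarrow> s"
  proof (rule tendsto_sandwich[OF _ _ low up])
    show "\<forall>\<^sub>F L in sequentially. low L \<le> ln (real (gerrymander (L + 2))) / (4 * (real (L + 2))\<^sup>2)"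
      using eventually_ge_at_top[of 1]
    proof eventually_elim
      case (elim L)
      have "4 * log_wcas (L + 1) - 8 * ln (real L) = ln ((real (card (wcas L)) / (real L)\<^sup>2) ^ 4)"
        using C[of L] elim by (simp add: log_wcas_def ln_realpow ln_div)
      also have "\<dots> \<le> ln (real (gerrymander (L + 2)))"
        using lower[OF elim] pos[OF elim] C[of L] elim by (subst ln_le_cancel_iff) auto
      finally show ?case unfolding low_def by (intro divide_right_mono) auto
    qed
    show "\<forall>\<^sub>F L in sequentially. ln (real (gerrymander (L + 2))) / (4 * (real (L + 2))\<^sup>2) \<le> up L"
      using eventually_ge_at_top[of 1]
    proof eventually_elim
      case (elim L)
      have "gerrymander (L + 2) \<le> 2 * (2 * L + 5) ^ 4 * card (wcas (2 * L + 8))"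
      proof -
        have "2 * (L + 2) + 1 = 2 * L + 5" "2 * (L + 2) + 4 = 2 * L + 8" "1 \<le> L + 2" by simp_all
        then show ?thesis using gerrymander_le[of "L + 2"] by metis
      qed
      then have "real (gerrymander (L + 2)) \<le> real (2 * (2 * L + 5) ^ 4 * card (wcas (2 * L + 8)))"
        by (simp only: of_nat_le_iff)
      then have "real (gerrymander (L + 2)) \<le> 2 * (2 * real L + 5) ^ 4 * real (card (wcas (2 * L + 8)))"
        by simp
      then have "ln (real (gerrymander (L + 2))) \<le>
          ln (2 * (2 * real L + 5) ^ 4 * real (card (wcas (2 * L + 8))))"
        using pos[OF elim] C[of "2 * L + 8"] by (subst ln_le_cancel_iff) auto
      also have "\<dots> = ln 2 + 4 * ln (2 * real L + 5) + log_wcas (2 * L + 9)"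
      proof -
        have "2 * L + 9 - 1 = 2 * L + 8" by simp
        then have "log_wcas (2 * L + 9) = ln (real (card (wcas (2 * L + 8))))"
          unfolding log_wcas_def by (simp only:)
        then show ?thesis using C[of "2 * L + 8"] by (simp add: ln_mult ln_realpow)
      qed
      finally show ?case unfolding up_def by (intro divide_right_mono) auto
    qed
  qed
  then have "(\<lambda>L. exp (ln (real (gerrymander (L + 2))) / (4 * (real (L + 2))\<^sup>2))) \<longlonglongrightarrow> exp s"
    by (rule tendsto_exp)
  moreover have "\<forall>\<^sub>F L in sequentially. exp (ln (real (gerrymander (L + 2))) / (4 * (real (L + 2))\<^sup>2)) =
      real (gerrymander (L + 2)) powr (1 / (4 * (real (L + 2))\<^sup>2))"
    using eventually_ge_at_top[of 1]
  proof eventually_elim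
    case (elim L)
    then show ?case using pos[OF elim] by (simp add: powr_def)
  qed
  ultimately have "(\<lambda>L. real (gerrymander (L + 2)) powr (1 / (4 * (real (L + 2))\<^sup>2))) \<longlonglongrightarrow> exp s"
    by (rule Lim_transform_eventually)
  then have "(\<lambda>L. real (gerrymander L) powr (1 / (4 * (real L)\<^sup>2))) \<longlonglongrightarrow> exp s"
    by (rule LIMSEQ_offset)
  then show ?thesis using lower wcas_lim by blast
qed

end
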